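(* Let $X$ be a piecewise deterministic Markov process with values in $[0,1]$, with local characteristics $(h,\lambda,Q)$, whose jump measure $\mu^X$ has compensator $$\nu^X(ds\,dx)=(\lambda(X_{s-})\,ds+dp^*_s)\,Q(X_{s-},dx),\qquad p^*_t=\sum_{n\ge1}1_{\{t\ge T_n\}}1_{\{X_{T_n-}\in\{0,1\}\}},$$ and let $dA_s=\lambda(X_{s-})\,ds+dp^*_s$. Let $(Y,U)\in\mathcal L^2\times\mathcal G^2(\mu^X)$ be a solution to the BSDE $$Y_t=g(X_T)+\int_{]t,T]}f(s,X_{s-},Y_{s-},U_s(\cdot))\,dA_s-\int_{]t,T]\times\mathbb{R}}U_s(x)\,(\mu^X-\nu^X)(ds\,dx).$$ Assume that $Y_t=v(t,X_t)$ for some continuous function $v$. Then $$\int_{]0,t]\times\mathbb{R}}H_s(x)\,(\mu^X-\nu^X)(ds\,dx)=0,\qquad\forall t\in]0,T],\ \text{a.s.},$$ where $H_s(x):=U_s(x)-(v(s,X_{s-}+x)-v(s,X_{s-}))$. If, in addition, $H\in\mathcal G^2_{\rm loc}(\mu^X)$, then $$U_s(x)=v(s,X_{s-}+x)-v(s,X_{s-})\qquad d\mathbb P\,\lambda(X_{s-})\,Q(X_{s-},dx)\,1_{\{X_{s-}\in]0,1[\}}\,ds\text{-a.e.},$$ and there exists a predictable process $(l_s)$ such that $$U_s(x)=v(s,X_{s-}+x)-v(s,X_{s-})+l_s\qquad d\mathbb P\,Q(X_{s-},dx)\,1_{\{X_{s-}\in\{0,1\}\}}\,dp^*_s\text{-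a.e.}$$
   Context: Fix $T>0$ and a filtered probability space $(\Omega,\mathcal F,(\mathcal F_t),\mathbb P)$ satisfying the usual conditions, with $\mathcal F=\mathcal F_T$. $\mathcal P$ is the predictable $\sigma$-field on $\Omega\times[0,T]$ and $\tilde{\mathcal P}=\mathcal P\otimes\mathcal B(\mathbb{R})$. $\mathcal A^+$ (resp. $\mathcal A^+_{\rm loc}$) is the class of adapted integrable (resp. locally integrable) increasing processes. The jump measure of $X$ is $\mu^X(dt\,dx)=\sum_{s\in]0,T]}1_{\{\Delta X_s\neq0\}}\delta_{(s,\Delta X_s)}(dt\,dx)$. PDMP (in the sense of Davis, with state space $[0,1]$): $X$ is generated by a marked point process $(T_n,\zeta_n)$, with $T_n\in]0,\infty[$ increasing random times that are either finitely many or satisfy $T_n\to\infty$, and $\zeta_n$ random variables in $[0,1]$. The local characteristics are: a Lipschitz function $h:]0,1[\to\mathbb{R}$; a bounded (nonnegative) measurable rate $\lambda:]0,1[\to\mathbb{R}$, extended by $0$ to $\{0,1\}$; and a transition probability $Q$ on $[0,1]\times\mathcal B(]-1,1[)$, where $Q(y,dx)$ is the law of the jump size $x$ from $y$. Let $\Phi(s,x)$ be the solution of $g'(s)=h(g(s))$, $g(0)=x$. Then $X_t=\Phi(t,X_0)$ for $t\in[0,T_1[$ and $X_t=\Phi(t-T_n,\zeta_n)$ for $t\in[T_n,T_{n+1}[$; $X$ is càdlàg with finitely many jumps on compact intervals and satisfies $X_t=X_0+\int_0^th(X_s)\,ds+\int_{]0,t]\times\mathbb{R}}x\,\mu^X(ds\,dx)$.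 The process jumps immediately when it reaches the boundary $\{0,1\}$; $p^*$ is the predictable process counting the jumps of $X$ from the boundary, and $\mathbb P$ is the probability under which $\nu^X$ has the stated form. In particular $\Delta A_s=\Delta p^*_s=1_{\{X_{s-}\in\{0,1\}\}}$ and $$\{(\omega,t):\nu^X(\{t\}\times\mathbb{R})>0\}=\{(\omega,t):\nu^X(\{t\}\times\mathbb{R})=1\}=\{(\omega,t):X_{t-}(\omega)\in\{0,1\}\}.$$ For $\tilde{\mathcal P}$-measurable $W$, $\hat W_t=\int W_t(x)\,\nu^X(\{t\},dx)$ and $\tilde W_t=\int W_t(x)\,\mu^X(\{t\},dx)-\hat W_t$ ($=+\infty$ if $\hat W_t$ is undefined); $\mathcal G^q(\mu^X)$ (resp. $\mathcal G^q_{\rm loc}(\mu^X)$) is the set of $\tilde{\mathcal P}$-measurable $W$ with $[\sum_{s\le\cdot}|\tilde W_s|^2]^{q/2}\in\mathcal A^+$ (resp. $\mathcal A^+_{\rm loc}$). For $W\in\mathcal G^1_{\rm loc}(\mu^X)$, $\int_{]0,\cdot]\times\mathbb{R}}W_s(x)(\mu^X-\nu^X)(ds\,dx)$ is the unique purely discontinuous local martingale null at $0$ with jump process $\tilde W$. $Y\in\mathcal L^2$ means that $\mathbb E\int_{]0,T]}|Y_{s-}|^2\,dA_s<\infty$. A solution $(Y,U)$ satisfies the equation for all $t$ a.s., with $Y$ adapted and càdlàg, $g(X_T)$ square integrable, $f$ such that the integrand $f(s,X_{s-},Y_{s-},U_s(\cdot))$ is predictable, and the drift integral existing and finite in the Lebesgue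 sense. The function $v$ is a deterministic function on $[0,T]\times\mathbb{R}$. *)

theory Defs
  imports "HOL-Probability.Probability"
begin

section \<open>Filtered probability spaces and processes on [0,T]\<close>

text \<open>
  The filtration is indexed by all reals so that the library notions \<open>filtration\<close> and
  \<open>stopping_time\<close> apply; only \<open>F t\<close> for \<open>0 \<le> t \<le> T\<close> carries information, since beyond
  \<open>T\<close> it is frozen at the ambient sigma-field. A process is written \<open>X t \<omega>\<close> and only its values
  for \<open>0 \<le> t \<le> T\<close> are relevant.
\<close>

definition filtered_prob_space :: "'a measure \<Rightarrow> (real \<Rightarrow> 'a measure) \<Rightarrow> real \<Rightarrow> bool" where
  "filtered_prob_space M F T \<longleftrightarrow>
     0 < T \<and> prob_space M \<and> complete_measure M \<and> filtration (space M) F \<and>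
     (\<forall>t\<ge>T. sets (F t) = sets M) \<and>
     null_sets M \<subseteq> sets (F 0) \<and>
     (\<forall>t\<in>{0..<T}. sets (F t) = (\<Inter>s\<in>{t<..T}. sets (F s)))"

definition adapted :: "(real \<Rightarrow> 'a measure) \<Rightarrow> real \<Rightarrow> (real \<Rightarrow> 'a \<Rightarrow> 'b::topological_space) \<Rightarrow> bool" where
  "adapted F T X \<longleftrightarrow> (\<forall>t\<in>{0..T}. X t \<in> borel_measurable (F t))"

definition cadlag :: "'a measure \<Rightarrow> real \<Rightarrow> (real \<Rightarrow> 'a \<Rightarrow> real) \<Rightarrow> bool" where
  "cadlag M T X \<longleftrightarrow> (\<forall>\<omega>\<in>space M.
     (\<forall>t\<in>{0..<T}. continuous (at_right t) (\<lambda>s. X s \<omega>)) \<and>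
     (\<forall>t\<in>{0<..T}. \<exists>l. ((\<lambda>s. X s \<omega>) \<longlongrightarrow> l) (at_left t)))"

definition left_lim :: "(real \<Rightarrow> 'a \<Rightarrow> real) \<Rightarrow> real \<Rightarrow> 'a \<Rightarrow> real" where
  "left_lim X t \<omega> = (if t \<le> 0 then X 0 \<omega> else Lim (at_left t) (\<lambda>s. X s \<omega>))"

definition jump :: "(real \<Rightarrow> 'a \<Rightarrow> real) \<Rightarrow> real \<Rightarrow> 'a \<Rightarrow> real" where
  "jump X t \<omega> = X t \<omega> - left_lim X t \<omega>"

definition predictable_sigma :: "'a measure \<Rightarrow> (real \<Rightarrow> 'a measure) \<Rightarrow> real \<Rightarrow> ('a \<times> real) measure" where
  "predictable_sigma M F T = sigma (space M \<times> {0..T})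
     ({A \<times> {0} |A. A \<in> sets (F 0)} \<union>
      {A \<times> {s<..t} |A s t. 0 \<le> s \<and> s \<le> t \<and> t \<le> T \<and> A \<in> sets (F s)})"

definition predictable :: "'a measure \<Rightarrow> (real \<Rightarrow> 'a measure) \<Rightarrow> real \<Rightarrow> (real \<Rightarrow> 'a \<Rightarrow> 'b::topological_space) \<Rightarrow> bool" where
  "predictable M F T l \<longleftrightarrow> (\<lambda>(\<omega>, s). l s \<omega>) \<in> borel_measurable (predictable_sigma M F T)"

definition predictable_sigma_tilde ::
    "'a measure \<Rightarrow> (real \<Rightarrow> 'a measure) \<Rightarrow> real \<Rightarrow> (('a \<times> real) \<times> real) measure" where
  "predictable_sigma_tilde M F T = predictable_sigma M F T \<Otimes>\<^sub>M (borel :: real measure)"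

text \<open>A random field is written \<open>W s \<omega> x\<close>, so that \<open>W s \<omega>\<close> is the function \<open>W\<^sub>s(\<cdot>)\<close>.\<close>

definition predictable_field ::
    "'a measure \<Rightarrow> (real \<Rightarrow> 'a measure) \<Rightarrow> real \<Rightarrow> (real \<Rightarrow> 'a \<Rightarrow> real \<Rightarrow> real) \<Rightarrow> bool" where
  "predictable_field M F T W \<longleftrightarrow>
     (\<lambda>((\<omega>, s), x). W s \<omega> x) \<in> borel_measurable (predictable_sigma_tilde M F T)"


section \<open>Localization, martingales, increasing processes\<close>

definition stopped :: "('a \<Rightarrow> real) \<Rightarrow> (real \<Rightarrow> 'a \<Rightarrow> 'b) \<Rightarrow> real \<Rightarrow> 'a \<Rightarrow> 'b" where
  "stopped \<tau> X t \<omega> = X (min t (\<tau> \<omega>)) \<omega>"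

text \<open>On the closed interval [0,T] a stopping time with value at least \<open>T\<close> does not stop anything;
  such values play the role of \<open>\<infinity>\<close>.\<close>

definition localizing :: "'a measure \<Rightarrow> (real \<Rightarrow> 'a measure) \<Rightarrow> real \<Rightarrow> (nat \<Rightarrow> 'a \<Rightarrow> real) \<Rightarrow> bool" where
  "localizing M F T \<tau> \<longleftrightarrow>
     (\<forall>n. stopping_time F (\<tau> n)) \<and>
     (\<forall>\<omega>\<in>space M. (\<forall>n. 0 \<le> \<tau> n \<omega>) \<and> incseq (\<lambda>n. \<tau> n \<omega>)) \<and>
     (AE \<omega> in M. \<exists>n. T \<le> \<tau> n \<omega>)"

definition martingale :: "'a measure \<Rightarrow> (real \<Rightarrow> 'a measure) \<Rightarrow> real \<Rightarrow> (real \<Rightarrow> 'a \<Rightarrow> real) \<Rightarrow> bool" where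
  "martingale M F T N \<longleftrightarrow> adapted F T N \<and> (\<forall>t\<in>{0..T}. integrable M (N t)) \<and>
     (\<forall>s t. 0 \<le> s \<and> s \<le> t \<and> t \<le> T \<longrightarrow> (AE \<omega> in M. real_cond_exp M (F s) (N t) \<omega> = N s \<omega>))"

definition local_martingale :: "'a measure \<Rightarrow> (real \<Rightarrow> 'a measure) \<Rightarrow> real \<Rightarrow> (real \<Rightarrow> 'a \<Rightarrow> real) \<Rightarrow> bool" where
  "local_martingale M F T N \<longleftrightarrow> adapted F T N \<and> cadlag M T N \<and>
     (\<exists>\<tau>. localizing M F T \<tau> \<and> (\<forall>n. martingale M F T (stopped (\<tau> n) N)))"

definition continuous_local_martingale ::
    "'a measure \<Rightarrow> (real \<Rightarrow> 'a measure) \<Rightarrow> real \<Rightarrow> (real \<Rightarrow> 'a \<Rightarrow> real) \<Rightarrow> bool" where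
  "continuous_local_martingale M F T L \<longleftrightarrow> local_martingale M F T L \<and>
     (\<forall>\<omega>\<in>space M. continuous_on {0..T} (\<lambda>t. L t \<omega>))"

text \<open>Purely discontinuous: null at 0 and orthogonal to every continuous local martingale.\<close>

definition purely_discontinuous_local_martingale ::
    "'a measure \<Rightarrow> (real \<Rightarrow> 'a measure) \<Rightarrow> real \<Rightarrow> (real \<Rightarrow> 'a \<Rightarrow> real) \<Rightarrow> bool" where
  "purely_discontinuous_local_martingale M F T N \<longleftrightarrow> local_martingale M F T N \<and>
     (AE \<omega> in M. N 0 \<omega> = 0) \<and>
     (\<forall>L. continuous_local_martingale M F T L \<longrightarrow> local_martingale M F T (\<lambda>t \<omega>. N t \<omega> * L t \<omega>))"

text \<open>
  The classes \<open>\<A>\<^sup>+\<close> and \<open>\<A>\<^sup>+\<^sub>l\<^sub>o\<^sub>c\<close>, for processes with values in \<open>[0,\<infinity>]\<close> (finiteness a.s. is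
  forced by integrability). The path properties are required up to a null set.
\<close>

definition A_plus :: "'a measure \<Rightarrow> (real \<Rightarrow> 'a measure) \<Rightarrow> real \<Rightarrow> (real \<Rightarrow> 'a \<Rightarrow> ennreal) set" where
  "A_plus M F T = {V. adapted F T V \<and>
     (AE \<omega> in M. V 0 \<omega> = 0 \<and> mono_on {0..T} (\<lambda>t. V t \<omega>) \<and>
                  (\<forall>t\<in>{0..<T}. continuous (at_right t) (\<lambda>s. V s \<omega>))) \<and>
     (\<integral>\<^sup>+\<omega>. V T \<omega> \<partial>M) < \<infinity>}"

definition A_plus_loc :: "'a measure \<Rightarrow> (real \<Rightarrow> 'a measure) \<Rightarrow> real \<Rightarrow> (real \<Rightarrow> 'a \<Rightarrow> ennreal) set" where
  "A_plus_loc M F T = {V. adapted F T V \<and>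
     (\<exists>\<tau>. localizing M F T \<tau> \<and> (\<forall>n. stopped (\<tau> n) V \<in> A_plus M F T))}"

text \<open>Measure \<open>dV\<^sub>s(\<omega>)\<close> on \<open>]0,T]\<close> of an increasing right-continuous process.\<close>

definition stieltjes :: "real \<Rightarrow> (real \<Rightarrow> 'a \<Rightarrow> real) \<Rightarrow> 'a \<Rightarrow> real measure" where
  "stieltjes T V \<omega> = restrict_space (interval_measure (\<lambda>t. V (max 0 (min t T)) \<omega>)) {0<..T}"


section \<open>Random measures\<close>

text \<open>A random measure is a family of measures \<open>\<eta> \<omega>\<close> on the Borel sets of pairs \<open>(s,x)\<close>,
  concentrated on \<open>]0,T] \<times> \<real>\<close>.\<close>

definition jump_measure :: "real \<Rightarrow> (real \<Rightarrow> 'a \<Rightarrow> real) \<Rightarrow> 'a \<Rightarrow> (real \<times> real) measure" where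
  "jump_measure T X \<omega> =
     distr (count_space {s\<in>{0<..T}. jump X s \<omega> \<noteq> 0}) borel (\<lambda>s. (s, jump X s \<omega>))"

definition rm_integral ::
    "('a \<Rightarrow> (real \<times> real) measure) \<Rightarrow> (('a \<times> real) \<times> real \<Rightarrow> ennreal) \<Rightarrow> real \<Rightarrow> 'a \<Rightarrow> ennreal" where
  "rm_integral \<eta> W t \<omega> =
     (\<integral>\<^sup>+z. W ((\<omega>, fst z), snd z) * indicator ({0<..t} \<times> UNIV) z \<partial>\<eta> \<omega>)"

text \<open>\<open>\<nu>\<close> is the compensator of \<open>\<mu>\<close>: it is a predictable random measure, and both assign the same
  expected integral to every nonnegative predictable field.\<close>

definition compensator ::
    "'a measure \<Rightarrow> (real \<Rightarrow> 'a measure) \<Rightarrow> real \<Rightarrow>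
     ('a \<Rightarrow> (real \<times> real) measure) \<Rightarrow> ('a \<Rightarrow> (real \<times> real) measure) \<Rightarrow> bool" where
  "compensator M F T \<mu> \<nu> \<longleftrightarrow>
     (\<forall>W\<in>borel_measurable (predictable_sigma_tilde M F T).
        predictable M F T (rm_integral \<nu> W) \<and>
        (\<integral>\<^sup>+\<omega>. rm_integral \<mu> W T \<omega> \<partial>M) = (\<integral>\<^sup>+\<omega>. rm_integral \<nu> W T \<omega> \<partial>M))"

text \<open>The measure \<open>\<P>(d\<omega>) \<eta>(\<omega>, ds dx)\<close> on the predictable sigma-field.\<close>

definition doleans ::
    "'a measure \<Rightarrow> (real \<Rightarrow> 'a measure) \<Rightarrow> real \<Rightarrow> ('a \<Rightarrow> (real \<times> real) measure) \<Rightarrow>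
     (('a \<times> real) \<times> real) measure" where
  "doleans M F T \<eta> =
     measure_of (space (predictable_sigma_tilde M F T)) (sets (predictable_sigma_tilde M F T))
       (\<lambda>B. \<integral>\<^sup>+\<omega>. emeasure (\<eta> \<omega>) {z. ((\<omega>, fst z), snd z) \<in> B} \<partial>M)"

text \<open>
  \<open>\<integral>W\<^sub>t(x) \<mu>({t},dx) - \<integral>W\<^sub>t(x) \<nu>({t},dx)\<close>, with value \<open>\<infinity>\<close> when the second integral is undefined,
  that is, when \<open>\<integral>|W\<^sub>t(x)| \<nu>({t},dx) = \<infinity>\<close>.
\<close>

definition W_tilde ::
    "('a \<Rightarrow> (real \<times> real) measure) \<Rightarrow> ('a \<Rightarrow> (real \<times> real) measure) \<Rightarrow>
     (real \<Rightarrow> 'a \<Rightarrow> real \<Rightarrow> real) \<Rightarrow> real \<Rightarrow> 'a \<Rightarrow> ereal" where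
  "W_tilde \<mu> \<nu> W t \<omega> =
     (if set_integrable (\<nu> \<omega>) ({t} \<times> UNIV) (\<lambda>(s, x). W s \<omega> x)
      then ereal ((LINT z:{t} \<times> UNIV|\<mu> \<omega>. (case z of (s, x) \<Rightarrow> W s \<omega> x)) -
                  (LINT z:{t} \<times> UNIV|\<nu> \<omega>. (case z of (s, x) \<Rightarrow> W s \<omega> x)))
      else \<infinity>)"

definition ennreal_powr :: "ennreal \<Rightarrow> real \<Rightarrow> ennreal" where
  "ennreal_powr a p = (if a = \<infinity> then \<infinity> else ennreal (enn2real a powr p))"

definition sum_sq_powr ::
    "('a \<Rightarrow> (real \<times> real) measure) \<Rightarrow> ('a \<Rightarrow> (real \<times> real) measure) \<Rightarrow> real \<Rightarrow>
     (real \<Rightarrow> 'a \<Rightarrow> real \<Rightarrow> real) \<Rightarrow> real \<Rightarrow> 'a \<Rightarrow> ennreal" where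
  "sum_sq_powr \<mu> \<nu> q W t \<omega> =
     ennreal_powr (\<integral>\<^sup>+s. (e2ennreal \<bar>W_tilde \<mu> \<nu> W s \<omega>\<bar>)\<^sup>2 \<partial>count_space {0<..t}) (q / 2)"

definition G ::
    "'a measure \<Rightarrow> (real \<Rightarrow> 'a measure) \<Rightarrow> real \<Rightarrow> ('a \<Rightarrow> (real \<times> real) measure) \<Rightarrow>
     ('a \<Rightarrow> (real \<times> real) measure) \<Rightarrow> real \<Rightarrow> (real \<Rightarrow> 'a \<Rightarrow> real \<Rightarrow> real) set" where
  "G M F T \<mu> \<nu> q = {W. predictable_field M F T W \<and> sum_sq_powr \<mu> \<nu> q W \<in> A_plus M F T}"

definition G_loc ::
    "'a measure \<Rightarrow> (real \<Rightarrow> 'a measure) \<Rightarrow> real \<Rightarrow> ('a \<Rightarrow> (real \<times> real) measure) \<Rightarrow>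
     ('a \<Rightarrow> (real \<times> real) measure) \<Rightarrow> real \<Rightarrow> (real \<Rightarrow> 'a \<Rightarrow> real \<Rightarrow> real) set" where
  "G_loc M F T \<mu> \<nu> q = {W. predictable_field M F T W \<and> sum_sq_powr \<mu> \<nu> q W \<in> A_plus_loc M F T}"

text \<open>
  \<open>N\<close> is (a version of) the process \<open>t \<mapsto> \<integral>\<^bsub>]0,t] \<times> \<real>\<^esub> W\<^sub>s(x) (\<mu> - \<nu>)(ds dx)\<close>. The process is unique only
  up to indistinguishability, so the integral is a relation.
\<close>

definition has_compensated_integral ::
    "'a measure \<Rightarrow> (real \<Rightarrow> 'a measure) \<Rightarrow> real \<Rightarrow> ('a \<Rightarrow> (real \<times> real) measure) \<Rightarrow>
     ('a \<Rightarrow> (real \<times> real) measure) \<Rightarrow> (real \<Rightarrow> 'a \<Rightarrow> real \<Rightarrow> real) \<Rightarrow> (real \<Rightarrow> 'a \<Rightarrow> real) \<Rightarrow> bool" where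
  "has_compensated_integral M F T \<mu> \<nu> W N \<longleftrightarrow>
     W \<in> G_loc M F T \<mu> \<nu> 1 \<and> purely_discontinuous_local_martingale M F T N \<and>
     (AE \<omega> in M. \<forall>t\<in>{0<..T}. ereal (jump N t \<omega>) = W_tilde \<mu> \<nu> W t \<omega>)"


section \<open>Piecewise deterministic Markov processes on [0,1]\<close>

definition local_characteristics :: "(real \<Rightarrow> real) \<Rightarrow> (real \<Rightarrow> real) \<Rightarrow> (real \<Rightarrow> real measure) \<Rightarrow> bool" where
  "local_characteristics h lam Q \<longleftrightarrow>
     (\<exists>L. L-lipschitz_on {0<..<1} h) \<and>
     lam \<in> borel_measurable (restrict_space borel {0<..<1}) \<and>
     (\<exists>C. \<forall>y\<in>{0<..<1}. 0 \<le> lam y \<and> lam y \<le> C) \<and> lam 0 = 0 \<and> lam 1 = 0 \<and>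
     Q \<in> restrict_space borel {0..1} \<rightarrow>\<^sub>M prob_algebra (restrict_space borel {-1<..<1})"

text \<open>\<open>Tn 0 = 0\<close> and \<open>\<zeta> 0\<close> (the initial state) are conventions; \<open>Tn n \<omega> = \<infinity>\<close> means that there is no
  \<open>n\<close>-th point. Divergence to \<open>\<infinity>\<close> then covers both finitely many points and \<open>T\<^sub>n \<rightarrow> \<infinity>\<close>.\<close>

definition marked_point_process :: "'a measure \<Rightarrow> (nat \<Rightarrow> 'a \<Rightarrow> ereal) \<Rightarrow> (nat \<Rightarrow> 'a \<Rightarrow> real) \<Rightarrow> bool" where
  "marked_point_process M Tn \<zeta> \<longleftrightarrow>
     (\<forall>n. Tn n \<in> borel_measurable M \<and> \<zeta> n \<in> borel_measurable M) \<and>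
     (\<forall>\<omega>\<in>space M. Tn 0 \<omega> = 0 \<and> incseq (\<lambda>n. Tn n \<omega>) \<and>
        (\<forall>n. Tn n \<omega> < \<infinity> \<longrightarrow> Tn n \<omega> < Tn (Suc n) \<omega>) \<and>
        (\<lambda>n. Tn n \<omega>) \<longlonglongrightarrow> \<infinity> \<and>
        (\<forall>n. \<zeta> n \<omega> \<in> {0..1}))"

text \<open>\<open>g\<close> solves \<open>g' = h(g)\<close>, \<open>g(0) = x\<close> on the interval \<open>S\<close> (with left end point 0). Since \<open>h\<close> lives on
  the open interval \<open>]0,1[\<close>, so does the solution at positive times.\<close>

definition flow_solution :: "(real \<Rightarrow> real) \<Rightarrow> real \<Rightarrow> real set \<Rightarrow> (real \<Rightarrow> real) \<Rightarrow> bool" where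
  "flow_solution h x S g \<longleftrightarrow> g 0 = x \<and> continuous_on S g \<and>
     (\<forall>s\<in>S - {0}. g s \<in> {0<..<1} \<and> (g has_real_derivative h (g s)) (at s within S))"

text \<open>
  Between consecutive times \<open>T\<^sub>n\<close>, restricted to [0,T], \<open>X\<close> follows the flow \<open>\<Phi>\<close> inside \<open>]0,1[\<close>. Hence
  the left limit \<open>X\<^sub>s\<^sub>-\<close> can lie in \<open>{0,1}\<close> only if \<open>s\<close> is one of the \<open>T\<^sub>n\<close>, \<open>n \<ge> 1\<close>: the process
  jumps immediately when it reaches the boundary.
\<close>

definition pdmp ::
    "'a measure \<Rightarrow> (real \<Rightarrow> 'a measure) \<Rightarrow> real \<Rightarrow> (real \<Rightarrow> real) \<Rightarrow> (real \<Rightarrow> real) \<Rightarrow> (real \<Rightarrow> real measure) \<Rightarrow>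
     (real \<Rightarrow> real \<Rightarrow> real) \<Rightarrow> (nat \<Rightarrow> 'a \<Rightarrow> ereal) \<Rightarrow> (nat \<Rightarrow> 'a \<Rightarrow> real) \<Rightarrow> (real \<Rightarrow> 'a \<Rightarrow> real) \<Rightarrow> bool" where
  "pdmp M F T h lam Q \<Phi> Tn \<zeta> X \<longleftrightarrow>
     local_characteristics h lam Q \<and> marked_point_process M Tn \<zeta> \<and>
     adapted F T X \<and> cadlag M T X \<and>
     (\<forall>\<omega>\<in>space M. \<forall>n. Tn n \<omega> \<le> ereal T \<longrightarrow>
        (let t0 = real_of_ereal (Tn n \<omega>);
             S = {s. 0 \<le> s \<and> t0 + s \<le> T \<and> ereal (t0 + s) < Tn (Suc n) \<omega>}
         in flow_solution h (\<zeta> n \<omega>) S (\<lambda>s. \<Phi> s (\<zeta> n \<omega>)) \<and>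
            (\<forall>s\<in>S. X (t0 + s) \<omega> = \<Phi> s (\<zeta> n \<omega>))))"

definition p_star :: "(nat \<Rightarrow> 'a \<Rightarrow> ereal) \<Rightarrow> (real \<Rightarrow> 'a \<Rightarrow> real) \<Rightarrow> real \<Rightarrow> 'a \<Rightarrow> real" where
  "p_star Tn X t \<omega> =
     (\<Sum>n | 1 \<le> n \<and> Tn n \<omega> \<le> ereal t. indicator {0, 1} (left_lim X (real_of_ereal (Tn n \<omega>)) \<omega>))"

definition A_process :: "(real \<Rightarrow> real) \<Rightarrow> (nat \<Rightarrow> 'a \<Rightarrow> ereal) \<Rightarrow> (real \<Rightarrow> 'a \<Rightarrow> real) \<Rightarrow> real \<Rightarrow> 'a \<Rightarrow> real" where
  "A_process lam Tn X t \<omega> = (LBINT s:{0<..t}. lam (left_lim X s \<omega>)) + p_star Tn X t \<omega>"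

text \<open>The random measure \<open>K(\<omega>,ds) Q(X\<^sub>s\<^sub>-,dx)\<close>, for a random measure \<open>K \<omega>\<close> on \<open>]0,T]\<close>.\<close>

definition kernel_measure ::
    "('a \<Rightarrow> real measure) \<Rightarrow> (real \<Rightarrow> real measure) \<Rightarrow> (real \<Rightarrow> 'a \<Rightarrow> real) \<Rightarrow> 'a \<Rightarrow> (real \<times> real) measure" where
  "kernel_measure K Q X \<omega> = K \<omega> \<bind> (\<lambda>s. distr (Q (left_lim X s \<omega>)) borel (\<lambda>x. (s, x)))"

definition pdmp_compensator ::
    "real \<Rightarrow> (real \<Rightarrow> real) \<Rightarrow> (real \<Rightarrow> real measure) \<Rightarrow> (nat \<Rightarrow> 'a \<Rightarrow> ereal) \<Rightarrow> (real \<Rightarrow> 'a \<Rightarrow> real) \<Rightarrow>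
     'a \<Rightarrow> (real \<times> real) measure" where
  "pdmp_compensator T lam Q Tn X = kernel_measure (stieltjes T (A_process lam Tn X)) Q X"

text \<open>\<open>\<lambda>(X\<^sub>s\<^sub>-) Q(X\<^sub>s\<^sub>-,dx) 1\<^bsub>X\<^sub>s\<^sub>- \<in> ]0,1[\<^esub> ds\<close> and \<open>Q(X\<^sub>s\<^sub>-,dx) 1\<^bsub>X\<^sub>s\<^sub>- \<in> {0,1}\<^esub> dp\<^sup>*\<^sub>s\<close>.\<close>

definition interior_measure ::
    "real \<Rightarrow> (real \<Rightarrow> real) \<Rightarrow> (real \<Rightarrow> real measure) \<Rightarrow> (real \<Rightarrow> 'a \<Rightarrow> real) \<Rightarrow> 'a \<Rightarrow> (real \<times> real) measure" where
  "interior_measure T lam Q X = kernel_measure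
     (\<lambda>\<omega>. density (restrict_space lborel {0<..T})
        (\<lambda>s. ennreal (lam (left_lim X s \<omega>)) * indicator {0<..<1} (left_lim X s \<omega>))) Q X"

definition boundary_measure ::
    "real \<Rightarrow> (real \<Rightarrow> real measure) \<Rightarrow> (nat \<Rightarrow> 'a \<Rightarrow> ereal) \<Rightarrow> (real \<Rightarrow> 'a \<Rightarrow> real) \<Rightarrow>
     'a \<Rightarrow> (real \<times> real) measure" where
  "boundary_measure T Q Tn X = kernel_measure
     (\<lambda>\<omega>. density (stieltjes T (p_star Tn X) \<omega>) (\<lambda>s. indicator {0, 1} (left_lim X s \<omega>))) Q X"


section \<open>The BSDE\<close>

definition L2_space :: "'a measure \<Rightarrow> ('a \<Rightarrow> real measure) \<Rightarrow> (real \<Rightarrow> 'a \<Rightarrow> real) set" where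
  "L2_space M dA = {Y. (\<integral>\<^sup>+\<omega>. (\<integral>\<^sup>+s. ennreal (\<bar>left_lim Y s \<omega>\<bar>\<^sup>2) \<partial>dA \<omega>) \<partial>M) < \<infinity>}"

definition bsde_solution ::
    "'a measure \<Rightarrow> (real \<Rightarrow> 'a measure) \<Rightarrow> real \<Rightarrow> (real \<Rightarrow> 'a \<Rightarrow> real) \<Rightarrow> ('a \<Rightarrow> real measure) \<Rightarrow>
     ('a \<Rightarrow> (real \<times> real) measure) \<Rightarrow> ('a \<Rightarrow> (real \<times> real) measure) \<Rightarrow>
     (real \<Rightarrow> real) \<Rightarrow> (real \<Rightarrow> real \<Rightarrow> real \<Rightarrow> (real \<Rightarrow> real) \<Rightarrow> real) \<Rightarrow>
     (real \<Rightarrow> 'a \<Rightarrow> real) \<Rightarrow> (real \<Rightarrow> 'a \<Rightarrow> real \<Rightarrow> real) \<Rightarrow> bool" where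
  "bsde_solution M F T X dA \<mu> \<nu> g f Y U \<longleftrightarrow>
     adapted F T Y \<and> cadlag M T Y \<and>
     (\<lambda>\<omega>. g (X T \<omega>)) \<in> borel_measurable M \<and> integrable M (\<lambda>\<omega>. (g (X T \<omega>))\<^sup>2) \<and>
     predictable M F T (\<lambda>s \<omega>. f s (left_lim X s \<omega>) (left_lim Y s \<omega>) (U s \<omega>)) \<and>
     (AE \<omega> in M. set_integrable (dA \<omega>) {0<..T}
        (\<lambda>s. f s (left_lim X s \<omega>) (left_lim Y s \<omega>) (U s \<omega>))) \<and>
     (\<exists>N. has_compensated_integral M F T \<mu> \<nu> U N \<and>
        (AE \<omega> in M. \<forall>t\<in>{0..T}.
           Y t \<omega> = g (X T \<omega>)
             + (LINT s:{t<..T}|dA \<omega>. f s (left_lim X s \<omega>) (left_lim Y s \<omega>) (U s \<omega>))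
             - (N T \<omega> - N t \<omega>)))"

end

theory Submission
  imports Defs
begin

text \<open>
  Let \<open>V\<^sub>s(x) = v(s, X\<^sub>s\<^sub>- + x) - v(s, X\<^sub>s\<^sub>-)\<close>, so that \<open>H = U - V\<close>. Because \<open>Y\<^sub>t = v(t, X\<^sub>t)\<close> and \<open>v\<close> is continuous,
  the jump of \<open>Y\<close> at \<open>s\<close> is \<open>V\<^sub>s(\<Delta>X\<^sub>s)\<close>. The equation gives a second expression for this jump: the jump of the
  integral of \<open>U\<close> against \<open>\<mu> - \<nu>\<close>, minus the atom of \<open>f dA\<close> at \<open>s\<close>. The process \<open>A\<close> jumps exactly when \<open>X\<^sub>s\<^sub>-\<close> is on
  the boundary, and then by 1, because between the points of the process \<open>X\<close> flows inside the open interval (\<open>interval_measure_A_process\<close>).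
  Equating the two expressions (\<open>bsde_jump\<close>) shows that at every jump of \<open>X\<close>
  \<open>H\<^sub>s(\<Delta>X\<^sub>s) = k\<^sub>s\<close>, where \<open>k\<^sub>s = \<integral> U\<^sub>s(x) Q(X\<^sub>s\<^sub>-, dx) + f\<^sub>s\<close> if \<open>X\<^sub>s\<^sub>- \<in> {0,1}\<close> and \<open>k\<^sub>s = 0\<close> otherwise.

  The process \<open>k\<close> is predictable. Therefore \<open>{H \<noteq> k}\<close> is a predictable set that \<open>\<mu>\<close> does not charge, and the
  compensator \<open>\<nu>\<close> does not charge it either (\<open>compensator_null\<close>). The statements about \<open>U\<close> follow: over the interior
  \<open>k\<close> vanishes and \<open>U = V\<close>, and over the boundary \<open>U = V + k\<close>, so that \<open>l = k\<close> will do.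

  It also follows that the compensated jumps of \<open>H\<close> vanish. Over the interior \<open>\<nu>({s} \<times> \<real>) = 0\<close> and
  \<open>H\<^sub>s(\<Delta>X\<^sub>s) = 0\<close>. At a boundary time \<open>\<nu>({s}, \<cdot>)\<close> is a probability, \<open>H\<^sub>s\<close> equals the constant \<open>k\<^sub>s\<close> almost everywhere
  for it, and this constant is subtracted from \<open>H\<^sub>s(\<Delta>X\<^sub>s) = k\<^sub>s\<close>; if \<open>X\<close> happens not to jump there, neither does \<open>Y\<close>,
  and the two expressions for its jump say \<open>k\<^sub>s = 0\<close>. So the integral of \<open>H\<close> is a purely
  discontinuous local martingale without jumps, and such a process is orthogonal to itself and hence zero
  (\<open>purely_discontinuous_no_jump_zero\<close>).
\<close>

section \<open>The predictable sigma-field\<close>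

lemma filtered_prob_spaceD:
  assumes "filtered_prob_space M F T"
  shows "0 < T" "prob_space M" "complete_measure M" "space (F t) = space M"
    "sets (F T) = sets M" "null_sets M \<subseteq> sets (F 0)" "s \<le> t \<Longrightarrow> sets (F s) \<subseteq> sets (F t)"
  using assms by (auto simp: filtered_prob_space_def dest: filtration.space_F filtration.sets_F_mono)

lemma subalgebra_filtration:
  assumes "filtered_prob_space M F T" "t \<le> T"
  shows "subalgebra M (F t)"
  using filtered_prob_spaceD(4,5,7)[OF assms(1)] assms(2)
  unfolding subalgebra_def by metis

lemma space_predictable_sigma:
  assumes "filtered_prob_space M F T"
  shows "space (predictable_sigma M F T) = space M \<times> {0..T}"
  by (simp add: predictable_sigma_def space_measure_of_conv)

lemma predictable_generators:
  assumes fps: "filtered_prob_space M F T"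
  shows "{A \<times> {0} |A. A \<in> sets (F 0)} \<union>
      {A \<times> {s<..t} |A s t. 0 \<le> s \<and> s \<le> t \<and> t \<le> T \<and> A \<in> sets (F s)} \<subseteq> Pow (space M \<times> {0..T})"
  using filtered_prob_spaceD(1,4)[OF fps] sets.sets_into_space[of _ "F _"] by fastforce

lemma predictable_rectangle:
  assumes fps: "filtered_prob_space M F T" and "0 \<le> s" "s \<le> t" "t \<le> T" "A \<in> sets (F s)"
  shows "A \<times> {s<..t} \<in> sets (predictable_sigma M F T)"
  unfolding predictable_sigma_def sets_measure_of[OF predictable_generators[OF fps]]
  using assms by (intro sigma_sets.Basic) blast

lemma predictable_rectangle_0:
  assumes fps: "filtered_prob_space M F T" and "A \<in> sets (F 0)"
  shows "A \<times> {0} \<in> sets (predictable_sigma M F T)"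
  unfolding predictable_sigma_def sets_measure_of[OF predictable_generators[OF fps]]
  using assms by (intro sigma_sets.Basic) blast

lemma measurable_into_predictable_sigma:
  assumes fps: "filtered_prob_space M F T"
    and sp: "\<And>z. z \<in> space K \<Longrightarrow> \<phi> z \<in> space M \<times> {0..T}"
    and rect0: "\<And>A. A \<in> sets (F 0) \<Longrightarrow> \<phi> -` (A \<times> {0}) \<inter> space K \<in> sets K"
    and rect: "\<And>A s t. 0 \<le> s \<Longrightarrow> s \<le> t \<Longrightarrow> t \<le> T \<Longrightarrow> A \<in> sets (F s) \<Longrightarrow>
      \<phi> -` (A \<times> {s<..t}) \<inter> space K \<in> sets K"
  shows "\<phi> \<in> measurable K (predictable_sigma M F T)"
  unfolding predictable_sigma_def
  using predictable_generators[OF fps] sp rect0 rect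
  by (intro measurable_measure_of) auto

lemma measurable_predictable_section:
  assumes fps: "filtered_prob_space M F T" and \<omega>: "\<omega> \<in> space M"
  shows "(\<lambda>s. (\<omega>, s)) \<in> measurable (restrict_space borel {0..T}) (predictable_sigma M F T)"
proof (rule measurable_into_predictable_sigma[OF fps], goal_cases)
  case (1 z) then show ?case using \<omega> by (auto simp: space_restrict_space)
next
  case (2 A)
  have "(\<lambda>s. (\<omega>, s)) -` (A \<times> {0}) \<inter> space (restrict_space borel {0..T}) = (if \<omega> \<in> A then {0} else {})"
    using filtered_prob_spaceD(1)[OF fps] by (auto simp: space_restrict_space)
  then show ?case using filtered_prob_spaceD(1)[OF fps] by (simp add: sets_restrict_space_iff)
next
  case (3 A s t)
  have "(\<lambda>s. (\<omega>, s)) -` (A \<times> {s<..t}) \<inter> space (restrict_space borel {0..T}) = (if \<omega> \<in> A then {s<..t} else {})"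
    using 3 by (auto simp: space_restrict_space)
  moreover have "{s<..t} \<in> sets (restrict_space borel {0..T})"
    using 3 by (subst sets_restrict_space_iff) auto
  ultimately show ?case by simp
qed

lemma measurable_predictable_terminal:
  assumes fps: "filtered_prob_space M F T"
  shows "(\<lambda>\<omega>. (\<omega>, T)) \<in> measurable M (predictable_sigma M F T)"
proof (rule measurable_into_predictable_sigma[OF fps], goal_cases)
  case (1 z) then show ?case using filtered_prob_spaceD(1)[OF fps] by auto
next
  case (2 A)
  then show ?case using filtered_prob_spaceD(1)[OF fps] by (simp add: vimage_def)
next
  case (3 A s t)
  then have "A \<in> sets M" using subalgebra_filtration[OF fps, of s] by (auto simp: subalgebra_def)
  then have "A \<inter> space M \<in> sets M" by auto
  moreover have "(\<lambda>\<omega>. (\<omega>, T)) -` (A \<times> {s<..t}) \<inter> space M = (if s < T \<and> T \<le> t then A \<inter> space M else {})"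
    by auto
  ultimately show ?case by auto
qed

lemma measurable_predictable_time:
  assumes fps: "filtered_prob_space M F T"
  shows "snd \<in> borel_measurable (predictable_sigma M F T)"
proof (rule borel_measurableI_le)
  fix a
  have S: "space M \<in> sets (F 0)" using sets.top[of "F 0"] filtered_prob_spaceD(4)[OF fps, of 0] by simp
  have "{x \<in> space (predictable_sigma M F T). snd x \<le> a} =
      (if a < 0 then {} else space M \<times> {0} \<union> space M \<times> {0<..min a T})"
    using filtered_prob_spaceD(1)[OF fps] by (auto simp: space_predictable_sigma[OF fps])
  then show "{x \<in> space (predictable_sigma M F T). snd x \<le> a} \<in> sets (predictable_sigma M F T)"
    using filtered_prob_spaceD(1)[OF fps] predictable_rectangle[OF fps _ _ _ S] predictable_rectangle_0[OF fps S]
    by auto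
qed

lemma left_lim_tendsto:
  assumes "cadlag M T X" "\<omega> \<in> space M" "t \<in> {0<..T}"
  shows "((\<lambda>s. X s \<omega>) \<longlongrightarrow> left_lim X t \<omega>) (at_left t)"
proof -
  obtain l where l: "((\<lambda>s. X s \<omega>) \<longlongrightarrow> l) (at_left t)" using assms unfolding cadlag_def by blast
  then have "Lim (at_left t) (\<lambda>s. X s \<omega>) = l" by (intro tendsto_Lim) simp_all
  with l assms(3) show ?thesis by (simp add: left_lim_def)
qed

lemma left_lim_eqI:
  assumes "((\<lambda>s. X s \<omega>) \<longlongrightarrow> l) (at_left t)" "0 < t"
  shows "left_lim X t \<omega> = l"
  using assms tendsto_Lim[of "at_left t" "\<lambda>s. X s \<omega>" l] by (simp add: left_lim_def)

text \<open>The left limit is the pointwise limit of processes that are constant in time on the cells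
  \<open>]k/m, (k+1)/m]\<close>, with the value that \<open>X\<close> has at the left end of the cell; each cell contributes
  rectangles of the kind that generate the predictable sigma-field.\<close>

lemma predictable_left_lim:
  assumes fps: "filtered_prob_space M F T" and ad: "adapted F T X" and cad: "cadlag M T X"
  shows "(\<lambda>z. left_lim X (snd z) (fst z)) \<in> borel_measurable (predictable_sigma M F T)"
proof (rule borel_measurable_LIMSEQ_real)
  \<comment> \<open>The left end of the cell of \<open>s\<close>. Rounding up and subtracting 1 keeps it strictly below \<open>s\<close>,
    also when \<open>s\<close> is itself a grid point.\<close>
  define d where "d n s = (if s \<le> 0 then 0 else real_of_int (\<lceil>s * real (Suc n)\<rceil> - 1) / real (Suc n))" for n s
  have d_less: "d n s < s" "s - 1 / real (Suc n) \<le> d n s" "0 \<le> d n s" if s: "0 < s" for n s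
  proof -
    define N where "N = real (Suc n)"
    define q where "q = s * N"
    have N: "0 < N" by (simp add: N_def)
    then have "0 < q" using s by (simp add: q_def)
    then have "1 \<le> \<lceil>q\<rceil>" by simp
    then have "1 \<le> real_of_int \<lceil>q\<rceil>" by simp
    then have q: "0 \<le> real_of_int (\<lceil>q\<rceil> - 1)" "real_of_int (\<lceil>q\<rceil> - 1) < q" "q \<le> real_of_int (\<lceil>q\<rceil> - 1) + 1"
      using ceiling_correct[of q] by auto
    have d: "d n s = real_of_int (\<lceil>q\<rceil> - 1) / N" using s unfolding d_def q_def N_def by simp
    have s': "s = q / N" using N by (simp add: q_def)
    show "0 \<le> d n s" using q(1) N unfolding d by (rule divide_nonneg_pos)
    show "d n s < s" unfolding d by (subst s', rule divide_strict_right_mono[OF q(2) N])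
    have "s - 1 / N = (q - 1) / N" by (simp add: s' diff_divide_distrib)
    also have "\<dots> \<le> d n s" unfolding d using q(3) N by (intro divide_right_mono) simp_all
    finally show "s - 1 / real (Suc n) \<le> d n s" by (simp add: N_def)
  qed
  show "(\<lambda>n. X (d n (snd z)) (fst z)) \<longlonglongrightarrow> left_lim X (snd z) (fst z)"
    if z': "z \<in> space (predictable_sigma M F T)" for z
  proof -
    obtain \<omega> s where z: "z = (\<omega>, s)" "\<omega> \<in> space M" "0 \<le> s" "s \<le> T"
      using z' by (auto simp: space_predictable_sigma[OF fps])
    show ?thesis
    proof (cases "s = 0")
      case True then show ?thesis by (simp add: z d_def left_lim_def)
    next
      case False
      then have s: "0 < s" using z by simp
      have "(\<lambda>n. d n s) \<longlonglongrightarrow> s"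
      proof (rule tendsto_sandwich)
        show "(\<lambda>n. s - 1 / real (Suc n)) \<longlonglongrightarrow> s"
          using tendsto_diff[OF tendsto_const[of s] LIMSEQ_inverse_real_of_nat] by (simp add: inverse_eq_divide)
        show "(\<lambda>n. s) \<longlonglongrightarrow> s" by simp
      qed (use d_less[OF s] in \<open>auto intro!: always_eventually less_imp_le\<close>)
      moreover have "d n s \<in> {..<s} \<and> d n s \<noteq> s" for n
        using d_less(1)[OF s, of n] by auto
      ultimately have "filterlim (\<lambda>n. d n s) (at_left s) sequentially"
        unfolding filterlim_at by (blast intro: always_eventually)
      moreover have "s \<in> {0<..T}" using s z by simp
      ultimately have "(\<lambda>n. X (d n s) \<omega>) \<longlonglongrightarrow> left_lim X s \<omega>"
        by (rule filterlim_compose[OF left_lim_tendsto[OF cad z(2)], rotated])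
      then show ?thesis by (simp add: z)
    qed
  qed
  show "(\<lambda>z. X (d n (snd z)) (fst z)) \<in> borel_measurable (predictable_sigma M F T)" for n
  proof (rule measurableI)
    fix B :: "real set" assume B: "B \<in> sets borel"
    define c where "c k = real k / real (Suc n)" for k
    define S where "S k = X (c k) -` B \<inter> space M" for k
    have S: "S k \<in> sets (F (c k))" if "c k \<le> T" for k
      using ad that measurable_sets[of "X (c k)" "F (c k)" borel B] B filtered_prob_spaceD(4)[OF fps]
      by (auto simp: S_def adapted_def c_def)
    have d_c: "d n s = c k" if "s \<in> {c k<..c (Suc k)}" for s k
    proof -
      have "real k < s * real (Suc n)" "s * real (Suc n) \<le> real k + 1"
        using that by (auto simp: c_def divide_less_eq pos_le_divide_eq)
      then have "\<lceil>s * real (Suc n)\<rceil> = int k + 1" by linarith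
      moreover have "0 < s" using that le_less_trans[of 0 "c k" s] by (simp add: c_def)
      ultimately show ?thesis by (simp add: d_def c_def)
    qed
    have cell: "\<exists>k. s \<in> {c k<..c (Suc k)}" if "0 < s" for s
    proof -
      define k where "k = nat (\<lceil>s * real (Suc n)\<rceil> - 1)"
      have "0 < s * real (Suc n)" using that by simp
      then have "real k < s * real (Suc n)" "s * real (Suc n) \<le> real k + 1" unfolding k_def by linarith+
      then show ?thesis by (intro exI[of _ k]) (auto simp: c_def divide_less_eq pos_le_divide_eq)
    qed
    have "(\<lambda>z. X (d n (snd z)) (fst z)) -` B \<inter> space (predictable_sigma M F T) =
      S 0 \<times> {0} \<union> (\<Union>k. if c k \<le> T then S k \<times> {c k<..min (c (Suc k)) T} else {})" (is "?L = ?R")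
    proof (intro set_eqI iffI)
      fix z assume z: "z \<in> ?L"
      then have z1: "fst z \<in> space M" "0 \<le> snd z" "snd z \<le> T" "X (d n (snd z)) (fst z) \<in> B"
        by (auto simp: space_predictable_sigma[OF fps])
      show "z \<in> ?R"
      proof (cases "snd z = 0")
        case True then show ?thesis using z1 by (cases z) (auto simp: S_def d_def c_def)
      next
        case False
        then obtain k where k: "snd z \<in> {c k<..c (Suc k)}" using cell[of "snd z"] z1 by auto
        then have "z \<in> S k \<times> {c k<..min (c (Suc k)) T}" using z1 d_c[OF k] by (cases z) (auto simp: S_def)
        moreover have "c k \<le> T" using k z1 by auto
        ultimately show ?thesis by (intro UnI2 UN_I[of k]) auto
      qed
    next
      fix z assume "z \<in> ?R"
      then consider "z \<in> S 0 \<times> {0}" | k where "c k \<le> T" "z \<in> S k \<times> {c k<..min (c (Suc k)) T}"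
        by (auto split: if_splits)
      then show "z \<in> ?L"
      proof cases
        case 1 then show ?thesis
          using filtered_prob_spaceD(1)[OF fps] by (auto simp: S_def c_def d_def space_predictable_sigma[OF fps])
      next
        case 2
        then have "snd z \<in> {c k<..c (Suc k)}" "0 \<le> c k" by (auto simp: c_def)
        with d_c[OF this(1)] 2 show ?thesis by (auto simp: S_def space_predictable_sigma[OF fps])
      qed
    qed
    also have "\<dots> \<in> sets (predictable_sigma M F T)"
    proof (intro sets.Un sets.countable_UN)
      show "S 0 \<times> {0} \<in> sets (predictable_sigma M F T)"
        using S[of 0] filtered_prob_spaceD(1)[OF fps] by (intro predictable_rectangle_0[OF fps]) (simp add: c_def)
      have "S k \<times> {c k<..min (c (Suc k)) T} \<in> sets (predictable_sigma M F T)" if "c k \<le> T" for k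
        using that S[OF that] by (intro predictable_rectangle[OF fps]) (auto simp: c_def divide_right_mono)
      then show "range (\<lambda>k. if c k \<le> T then S k \<times> {c k<..min (c (Suc k)) T} else {}) \<subseteq> sets (predictable_sigma M F T)"
        by auto
    qed
    finally show "(\<lambda>z. X (d n (snd z)) (fst z)) -` B \<inter> space (predictable_sigma M F T) \<in> sets (predictable_sigma M F T)" .
  qed simp
qed

section \<open>Stieltjes measures\<close>

lemma interval_measure_eqI:
  fixes F :: "real \<Rightarrow> real"
  assumes mono: "\<And>x y. x \<le> y \<Longrightarrow> F x \<le> F y" and cont: "\<And>a. continuous (at_right a) F"
    and sets: "sets N = sets borel"
    and Ioc: "\<And>a b. a \<le> b \<Longrightarrow> emeasure N {a<..b} = ennreal (F b - F a)"
  shows "N = interval_measure F"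
proof (rule measure_eqI_generator_eq[of "range (\<lambda>(a, b). {a<..b})" UNIV])
  show "Int_stable (range (\<lambda>(a, b). {a<..b::real}))"
    by (rule Int_stableI) (force simp: Int_greaterThanAtMost)
  show "emeasure N X = emeasure (interval_measure F) X" if "X \<in> range (\<lambda>(a, b). {a<..b})" for X
  proof -
    from that obtain a b where X: "X = {a<..b}" by auto
    then show ?thesis
      using Ioc[of a b] emeasure_interval_measure_Ioc_eq[of F a b, OF mono cont] by (cases "a \<le> b") auto
  qed
  show "sets N = sigma_sets UNIV (range (\<lambda>(a, b). {a<..b::real}))"
       "sets (interval_measure F) = sigma_sets UNIV (range (\<lambda>(a, b). {a<..b::real}))"
    by (simp_all add: sets borel_sigma_sets_Ioc)
  show "range (\<lambda>n. {- real n<..real n}) \<subseteq> range (\<lambda>(a, b). {a<..b})" by auto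
  show "(\<Union>n. {- real n<..real n}) = UNIV"
  proof safe
    fix x :: real
    obtain n where "\<bar>x\<bar> < real n" using reals_Archimedean2 by blast
    then show "x \<in> (\<Union>n. {- real n<..real n})" by (intro UN_I[of n]) auto
  qed simp
  show "emeasure N {- real n<..real n} \<noteq> \<infinity>" for n by (subst Ioc) auto
qed auto

text \<open>This splits the measure of \<open>A\<close> into its absolutely continuous part and \<open>dp\<^sup>*\<close>.\<close>

lemma emeasure_interval_measure_add:
  fixes F G :: "real \<Rightarrow> real"
  assumes F: "\<And>x y. x \<le> y \<Longrightarrow> F x \<le> F y" "\<And>a. continuous (at_right a) F"
    and G: "\<And>x y. x \<le> y \<Longrightarrow> G x \<le> G y" "\<And>a. continuous (at_right a) G"
    and B: "B \<in> sets borel"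
  shows "emeasure (interval_measure (\<lambda>x. F x + G x)) B =
    emeasure (interval_measure F) B + emeasure (interval_measure G) B"
proof -
  define N where "N = measure_of UNIV (sets borel)
    (\<lambda>B. emeasure (interval_measure F) B + emeasure (interval_measure G) B)"
  have sets: "sets N = sets borel" using sets.sigma_sets_eq[of borel] by (simp add: N_def sets_measure_of_conv)
  have N: "emeasure N B = emeasure (interval_measure F) B + emeasure (interval_measure G) B"
    if "B \<in> sets borel" for B
    unfolding N_def
  proof (rule emeasure_measure_of_sigma)
    show "countably_additive (sets borel) (\<lambda>B. emeasure (interval_measure F) B + emeasure (interval_measure G) B)"
    proof (rule countably_additiveI, goal_cases)
      case (1 A)
      then have "(\<Sum>i. emeasure (interval_measure F) (A i) + emeasure (interval_measure G) (A i)) =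
        (\<Sum>i. emeasure (interval_measure F) (A i)) + (\<Sum>i. emeasure (interval_measure G) (A i))"
        by (intro suminf_add[symmetric]) auto
      then show ?case using 1 by (simp add: suminf_emeasure)
    qed
  qed (use that sets.sigma_algebra_axioms[of borel] in \<open>simp_all add: positive_def\<close>)
  have "N = interval_measure (\<lambda>x. F x + G x)"
  proof (rule interval_measure_eqI)
    show "emeasure N {a<..b} = ennreal (F b + G b - (F a + G a))" if "a \<le> b" for a b
      using that F(1)[OF that] G(1)[OF that]
      by (simp add: N emeasure_interval_measure_Ioc_eq[of F, OF F]
          emeasure_interval_measure_Ioc_eq[of G, OF G] ennreal_plus[symmetric] algebra_simps del: ennreal_plus)
  qed (use F G sets in \<open>auto intro: add_mono continuous_intros\<close>)
  with N[OF B] show ?thesis by simp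
qed

lemma emeasure_interval_measure_singleton:
  fixes F :: "real \<Rightarrow> real"
  assumes mono: "\<And>x y. x \<le> y \<Longrightarrow> F x \<le> F y" and cont: "\<And>a. continuous (at_right a) F"
    and l: "(F \<longlongrightarrow> l) (at_left s)"
  shows "emeasure (interval_measure F) {s} = ennreal (F s - l)"
proof -
  have "(\<lambda>n. s - inverse (real (Suc n))) \<longlonglongrightarrow> s"
    using tendsto_diff[OF tendsto_const[of s] LIMSEQ_inverse_real_of_nat] by simp
  then have "filterlim (\<lambda>n. s - inverse (real (Suc n))) (at_left s) sequentially"
    by (auto simp: filterlim_at intro!: always_eventually)
  then have "(\<lambda>n. F (s - inverse (real (Suc n)))) \<longlonglongrightarrow> l" by (rule filterlim_compose[OF l])
  then have 1: "(\<lambda>n. ennreal (F s - F (s - inverse (real (Suc n))))) \<longlonglongrightarrow> ennreal (F s - l)"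
    by (intro tendsto_ennrealI tendsto_intros)
  have "(\<lambda>n. emeasure (interval_measure F) {s - inverse (real (Suc n))<..s}) \<longlonglongrightarrow>
    emeasure (interval_measure F) (\<Inter>n. {s - inverse (real (Suc n))<..s})"
  proof (rule Lim_emeasure_decseq)
    show "decseq (\<lambda>n. {s - inverse (real (Suc n))<..s})"
      unfolding decseq_Suc_iff
    proof (intro allI subsetI)
      fix n x assume "x \<in> {s - inverse (real (Suc (Suc n)))<..s}"
      moreover have "inverse (real (Suc (Suc n))) \<le> inverse (real (Suc n))"
        by (intro le_imp_inverse_le) auto
      ultimately show "x \<in> {s - inverse (real (Suc n))<..s}"
        unfolding greaterThanAtMost_iff by linarith
    qed
  qed (auto simp: emeasure_interval_measure_Ioc_eq[of F, OF mono cont])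
  also have "(\<Inter>n. {s - inverse (real (Suc n))<..s}) = {s}"
  proof (intro set_eqI iffI)
    fix x assume x: "x \<in> (\<Inter>n. {s - inverse (real (Suc n))<..s})"
    have "\<not> x < s"
    proof
      assume "x < s"
      then obtain n where "inverse (real (Suc n)) < s - x" using reals_Archimedean[of "s - x"] by auto
      moreover have "s - inverse (real (Suc n)) < x" using x by (meson INT_iff UNIV_I greaterThanAtMost_iff)
      ultimately show False by simp
    qed
    moreover have "x \<le> s" using x by auto
    ultimately show "x \<in> {s}" by simp
  qed auto
  also have "(\<lambda>n. emeasure (interval_measure F) {s - inverse (real (Suc n))<..s}) =
    (\<lambda>n. ennreal (F s - F (s - inverse (real (Suc n)))))"
    by (auto simp: emeasure_interval_measure_Ioc_eq[of F, OF mono cont])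
  finally show ?thesis using 1 LIMSEQ_unique by blast
qed

text \<open>The distribution function is integrated over \<open>{..t}\<close>, not over a bounded interval, so that it is
  nondecreasing and continuous on the whole line, as an \<open>interval_measure\<close> needs.\<close>

lemma interval_measure_integral:
  fixes l :: "real \<Rightarrow> real"
  assumes [measurable]: "l \<in> borel_measurable borel" and nonneg: "\<And>s. 0 \<le> l s" and int: "integrable lborel l"
  defines "I \<equiv> \<lambda>t. LBINT s:{..t}. l s"
  shows "\<And>x y. x \<le> y \<Longrightarrow> I x \<le> I y" "continuous_on UNIV I"
    "interval_measure I = density lborel (\<lambda>s. ennreal (l s))"
proof -
  have int': "set_integrable lborel {..t} l" "set_integrable lborel {s<..t} l" for s t
    using int unfolding set_integrable_def by (intro integrable_mult_indicator; simp)+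
  have Ioc: "I y = I x + (LBINT s:{x<..y}. l s)" if "x \<le> y" for x y
  proof -
    have "{..y} = {..x} \<union> {x<..y}" using that by auto
    moreover have "(LBINT s:{..x} \<union> {x<..y}. l s) = (LBINT s:{..x}. l s) + (LBINT s:{x<..y}. l s)"
      by (rule set_integral_Un) (auto simp: int')
    ultimately show ?thesis unfolding I_def by metis
  qed
  have nn: "0 \<le> (LBINT s:{x<..y}. l s)" for x y
    unfolding set_lebesgue_integral_def using nonneg by (intro integral_nonneg_AE) auto
  show mono: "I x \<le> I y" if "x \<le> y" for x y using Ioc[OF that] nn[of x y] by simp
  show cont: "continuous_on UNIV I"
    unfolding continuous_on_sequentially
  proof (intro ballI allI impI)
    fix x :: real and u :: "nat \<Rightarrow> real" assume "(\<forall>n. u n \<in> UNIV) \<and> u \<longlonglongrightarrow> x"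
    then have u: "u \<longlonglongrightarrow> x" by simp
    have "(\<lambda>n. I (u n)) \<longlonglongrightarrow> I x"
      unfolding I_def set_lebesgue_integral_def
    proof (rule integral_dominated_convergence[where w=l])
      show "AE s in lborel. (\<lambda>n. indicat_real {..u n} s *\<^sub>R l s) \<longlonglongrightarrow> indicat_real {..x} s *\<^sub>R l s"
        using AE_lborel_singleton[of x]
      proof eventually_elim
        case (elim s)
        then consider "s < x" | "x < s" by linarith
        then have "\<forall>\<^sub>F n in sequentially. indicat_real {..u n} s *\<^sub>R l s = indicat_real {..x} s *\<^sub>R l s"
        proof cases
          case 1
          then have "\<forall>\<^sub>F n in sequentially. s < u n" by (rule order_tendstoD(1)[OF u])
          then show ?thesis by eventually_elim (use 1 in \<open>auto simp: indicator_def\<close>)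
        next
          case 2
          then have "\<forall>\<^sub>F n in sequentially. u n < s" by (rule order_tendstoD(2)[OF u])
          then show ?thesis by eventually_elim (use 2 in \<open>auto simp: indicator_def\<close>)
        qed
        then show ?case by (rule tendsto_eventually)
      qed
    qed (use int nonneg in \<open>auto simp: indicator_def\<close>)
    then show "(I \<circ> u) \<longlonglongrightarrow> I x" by (simp add: comp_def)
  qed
  show "interval_measure I = density lborel (\<lambda>s. ennreal (l s))"
  proof (rule interval_measure_eqI[symmetric, OF mono])
    show "continuous (at_right a) I" for a
      using cont by (auto simp: continuous_on_eq_continuous_within intro: continuous_within_subset)
    show "emeasure (density lborel (\<lambda>s. ennreal (l s))) {a<..b} = ennreal (I b - I a)" if "a \<le> b" for a b
    proof -
      have "emeasure (density lborel (\<lambda>s. ennreal (l s))) {a<..b} = (\<integral>\<^sup>+s. ennreal (indicator {a<..b} s * l s) \<partial>lborel)"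
        by (subst emeasure_density) (auto intro!: nn_integral_cong simp: indicator_def)
      also have "\<dots> = ennreal (LBINT s:{a<..b}. l s)"
        unfolding set_lebesgue_integral_def using int'(2)[of a b] nonneg
        by (subst nn_integral_eq_integral) (auto simp: set_integrable_def)
      finally show ?thesis using Ioc[OF that] by simp
    qed
  qed auto
qed

section \<open>Paths of the process\<close>

lemma marked_point_processD:
  assumes "marked_point_process M Tn \<zeta>" "\<omega> \<in> space M"
  shows "Tn 0 \<omega> = 0" "incseq (\<lambda>n. Tn n \<omega>)" "(\<lambda>n. Tn n \<omega>) \<longlonglongrightarrow> \<infinity>" "\<zeta> n \<omega> \<in> {0..1}"
    "Tn n \<omega> < \<infinity> \<Longrightarrow> Tn n \<omega> < Tn (Suc n) \<omega>"
  using assms by (auto simp: marked_point_process_def)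

lemma point_times_less:
  assumes "marked_point_process M Tn \<zeta>" "\<omega> \<in> space M" "m < n" "Tn m \<omega> < \<infinity>"
  shows "Tn m \<omega> < Tn n \<omega>"
proof -
  have "Tn (Suc m) \<omega> \<le> Tn n \<omega>" using marked_point_processD(2)[OF assms(1,2)] assms(3) by (auto simp: incseq_def)
  then show ?thesis using marked_point_processD(5)[OF assms(1,2,4)] by simp
qed

lemma point_times_cell:
  assumes mpp: "marked_point_process M Tn \<zeta>" "\<omega> \<in> space M"
  shows "0 \<le> t \<Longrightarrow> \<exists>n. Tn n \<omega> \<le> ereal t \<and> ereal t < Tn (Suc n) \<omega>"
    "0 < t \<Longrightarrow> \<exists>n. Tn n \<omega> < ereal t \<and> ereal t \<le> Tn (Suc n) \<omega>"
    "finite {n. 1 \<le> n \<and> Tn n \<omega> \<le> ereal t}"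
proof -
  have "\<forall>\<^sub>F n in sequentially. ereal t < Tn n \<omega>"
    using order_tendstoD(1)[OF marked_point_processD(3)[OF mpp]] by simp
  then obtain N where N: "\<And>n. N \<le> n \<Longrightarrow> ereal t < Tn n \<omega>" by (auto simp: eventually_sequentially)
  then have "{n. 1 \<le> n \<and> Tn n \<omega> \<le> ereal t} \<subseteq> {..<N}"
    by (metis (mono_tags, lifting) lessThan_iff linorder_not_le mem_Collect_eq subsetI)
  then show "finite {n. 1 \<le> n \<and> Tn n \<omega> \<le> ereal t}" by (rule finite_subset) simp
  show "\<exists>n. Tn n \<omega> \<le> ereal t \<and> ereal t < Tn (Suc n) \<omega>" if t: "0 \<le> t"
  proof -
    define m where "m = (LEAST n. ereal t < Tn n \<omega>)"
    have m: "ereal t < Tn m \<omega>" unfolding m_def by (rule LeastI) (rule N[OF order_refl])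
    then obtain n where n: "m = Suc n" using marked_point_processD(1)[OF mpp] t by (cases m) auto
    then have "\<not> ereal t < Tn n \<omega>" using not_less_Least[of n "\<lambda>n. ereal t < Tn n \<omega>"] by (simp add: m_def)
    with m n show ?thesis by (intro exI[of _ n]) auto
  qed
  show "\<exists>n. Tn n \<omega> < ereal t \<and> ereal t \<le> Tn (Suc n) \<omega>" if t: "0 < t"
  proof -
    define m where "m = (LEAST n. ereal t \<le> Tn n \<omega>)"
    have m: "ereal t \<le> Tn m \<omega>" unfolding m_def by (rule LeastI[of _ N]) (use N[OF order_refl] in simp)
    then obtain n where n: "m = Suc n" using marked_point_processD(1)[OF mpp] t by (cases m) auto
    then have "\<not> ereal t \<le> Tn n \<omega>" using not_less_Least[of n "\<lambda>n. ereal t \<le> Tn n \<omega>"] by (simp add: m_def)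
    with m n show ?thesis by (intro exI[of _ n]) auto
  qed
qed

lemma pdmpD:
  assumes "pdmp M F T h lam Q \<Phi> Tn \<zeta> X"
  shows "local_characteristics h lam Q" "marked_point_process M Tn \<zeta>" "adapted F T X" "cadlag M T X"
  using assms by (auto simp: pdmp_def)

lemma pdmp_flow:
  assumes X: "pdmp M F T h lam Q \<Phi> Tn \<zeta> X" and \<omega>: "\<omega> \<in> space M" and "Tn n \<omega> = ereal t0" "t0 \<le> T"
  defines "S \<equiv> {s. 0 \<le> s \<and> t0 + s \<le> T \<and> ereal (t0 + s) < Tn (Suc n) \<omega>}"
  shows "flow_solution h (\<zeta> n \<omega>) S (\<lambda>s. \<Phi> s (\<zeta> n \<omega>))" "\<And>s. s \<in> S \<Longrightarrow> X (t0 + s) \<omega> = \<Phi> s (\<zeta> n \<omega>)"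
proof -
  have le: "Tn n \<omega> \<le> ereal T" using assms(3,4) by simp
  have "let t0 = real_of_ereal (Tn n \<omega>);
             S = {s. 0 \<le> s \<and> t0 + s \<le> T \<and> ereal (t0 + s) < Tn (Suc n) \<omega>}
         in flow_solution h (\<zeta> n \<omega>) S (\<lambda>s. \<Phi> s (\<zeta> n \<omega>)) \<and>
            (\<forall>s\<in>S. X (t0 + s) \<omega> = \<Phi> s (\<zeta> n \<omega>))"
    using X \<omega> le unfolding pdmp_def by blast
  then show "flow_solution h (\<zeta> n \<omega>) S (\<lambda>s. \<Phi> s (\<zeta> n \<omega>))" "\<And>s. s \<in> S \<Longrightarrow> X (t0 + s) \<omega> = \<Phi> s (\<zeta> n \<omega>)"
    unfolding S_def by (simp_all add: assms(3) Let_def)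
qed

lemma point_time_finite:
  assumes mpp: "marked_point_process M Tn \<zeta>" "\<omega> \<in> space M" and "Tn n \<omega> \<le> ereal t"
  obtains t0 where "Tn n \<omega> = ereal t0" "0 \<le> t0" "t0 \<le> t"
proof -
  have "0 \<le> Tn n \<omega>"
    using marked_point_processD(1,2)[OF mpp] by (metis incseqD le0)
  with assms(3) that show ?thesis by (cases "Tn n \<omega>") auto
qed

lemma pdmp_range:
  assumes X: "pdmp M F T h lam Q \<Phi> Tn \<zeta> X" and \<omega>: "\<omega> \<in> space M" and t: "t \<in> {0..T}"
  shows "X t \<omega> \<in> {0..1}"
proof -
  note mpp = pdmpD(2)[OF X] \<omega>
  obtain n where n: "Tn n \<omega> \<le> ereal t" "ereal t < Tn (Suc n) \<omega>" using point_times_cell(1)[OF mpp] t by auto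
  obtain t0 where t0: "Tn n \<omega> = ereal t0" "0 \<le> t0" "t0 \<le> t" by (rule point_time_finite[OF mpp n(1)])
  have "t0 \<le> T" using t0 t by simp
  note fl = pdmp_flow[OF X \<omega> t0(1) this]
  have "X (t0 + (t - t0)) \<omega> = \<Phi> (t - t0) (\<zeta> n \<omega>)" using t0 t n by (intro fl(2)) auto
  moreover have "\<Phi> (t - t0) (\<zeta> n \<omega>) \<in> {0..1}"
  proof (cases "t = t0")
    case True
    then show ?thesis using fl(1) marked_point_processD(4)[OF mpp] by (simp add: flow_solution_def)
  next
    case False
    then have "\<Phi> (t - t0) (\<zeta> n \<omega>) \<in> {0<..<1}" using fl(1) t0 t n unfolding flow_solution_def by auto
    then show ?thesis by auto
  qed
  ultimately show ?thesis by simp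
qed

lemma pdmp_left_lim_range:
  assumes X: "pdmp M F T h lam Q \<Phi> Tn \<zeta> X" and \<omega>: "\<omega> \<in> space M" and t: "t \<in> {0..T}"
  shows "left_lim X t \<omega> \<in> {0..1}"
proof (cases "t = 0")
  case True
  then show ?thesis using pdmp_range[OF X \<omega> t] by (simp add: left_lim_def)
next
  case False
  then have t': "t \<in> {0<..T}" using t by auto
  have "\<forall>\<^sub>F s in at_left t. 0 < s \<and> s < t"
    using t' by (intro eventually_at_leftI[of 0]) auto
  then have "\<forall>\<^sub>F s in at_left t. X s \<omega> \<in> {0..1}"
    by eventually_elim (use t' pdmp_range[OF X \<omega>] in auto)
  then show ?thesis
    using left_lim_tendsto[OF pdmpD(4)[OF X] \<omega> t'] by (intro Lim_in_closed_set[of "{0..1}"]) auto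
qed

text \<open>Between two points the path is a solution of the flow at a positive time, hence continuous with
  values in the open interval; so the left limit reaches the boundary at the points only.\<close>

lemma pdmp_boundary_only_at_points:
  assumes X: "pdmp M F T h lam Q \<Phi> Tn \<zeta> X" and \<omega>: "\<omega> \<in> space M" and t: "t \<in> {0<..T}"
    and bd: "left_lim X t \<omega> \<in> {0, 1}"
  shows "\<exists>n\<ge>1. Tn n \<omega> = ereal t"
proof -
  note mpp = pdmpD(2)[OF X] \<omega>
  obtain n where n: "Tn n \<omega> < ereal t" "ereal t \<le> Tn (Suc n) \<omega>" using point_times_cell(2)[OF mpp] t by auto
  obtain t0 where t0: "Tn n \<omega> = ereal t0" "0 \<le> t0" "t0 \<le> t" by (rule point_time_finite[OF mpp less_imp_le[OF n(1)]])
  have "t0 < t" "t0 \<le> T" using t0 t n by auto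
  note fl = pdmp_flow[OF X \<omega> t0(1) this(2)]
  define S where "S = {s. 0 \<le> s \<and> t0 + s \<le> T \<and> ereal (t0 + s) < Tn (Suc n) \<omega>}"
  have "Tn (Suc n) \<omega> = ereal t"
  proof (rule ccontr)
    assume "Tn (Suc n) \<omega> \<noteq> ereal t"
    then have lt: "ereal t < Tn (Suc n) \<omega>" using n by auto
    have inS: "s \<in> S" if "0 \<le> s" "s \<le> t - t0" for s
      using that t lt le_less_trans[of "ereal (t0 + s)" "ereal t"] by (auto simp: S_def)
    have cont: "continuous_on {t0..t} (\<lambda>s. \<Phi> (s - t0) (\<zeta> n \<omega>))"
    proof (rule continuous_on_compose2[where g="\<lambda>s. \<Phi> s (\<zeta> n \<omega>)" and t=S])
      show "continuous_on S (\<lambda>s. \<Phi> s (\<zeta> n \<omega>))" using fl(1) by (auto simp: flow_solution_def S_def)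
    qed (auto intro!: continuous_intros inS)
    have "continuous_on {t0..t} (\<lambda>s. X s \<omega>)"
    proof (rule continuous_on_eq[OF cont])
      fix s assume "s \<in> {t0..t}"
      then have "X (t0 + (s - t0)) \<omega> = \<Phi> (s - t0) (\<zeta> n \<omega>)" using inS[of "s - t0"] by (intro fl(2)) (auto simp: S_def)
      then show "\<Phi> (s - t0) (\<zeta> n \<omega>) = X s \<omega>" by simp
    qed
    then have "((\<lambda>s. X s \<omega>) \<longlongrightarrow> X t \<omega>) (at t within {t0..t})"
      using \<open>t0 < t\<close> by (auto simp: continuous_on)
    then have "((\<lambda>s. X s \<omega>) \<longlongrightarrow> X t \<omega>) (at_left t)"
      using \<open>t0 < t\<close> by (simp add: at_within_Icc_at_left)
    then have "left_lim X t \<omega> = X t \<omega>" using t by (intro left_lim_eqI) auto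
    also have "\<dots> = \<Phi> (t - t0) (\<zeta> n \<omega>)" using fl(2)[of "t - t0"] inS[of "t - t0"] \<open>t0 < t\<close> by (simp add: S_def)
    also have "\<dots> \<in> {0<..<1}" using fl(1) inS[of "t - t0"] \<open>t0 < t\<close> unfolding flow_solution_def S_def by auto
    finally show False using bd by auto
  qed
  then show ?thesis by (intro exI[of _ "Suc n"]) simp
qed


section \<open>The measure of the process A\<close>

text \<open>With time clamped to \<open>[0,T]\<close>, the index set of the sum no longer depends on the time: \<open>p\<^sup>*\<close>
  becomes a fixed finite sum of unit steps, and its monotonicity, right continuity and jumps can be read off term by term.\<close>

lemma p_star_eq_sum:
  assumes mpp: "marked_point_process M Tn \<zeta>" "\<omega> \<in> space M" and "0 < T"
  defines "I \<equiv> {n. 1 \<le> n \<and> Tn n \<omega> \<le> ereal T}"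
  shows "p_star Tn X (max 0 (min t T)) \<omega> = (\<Sum>n\<in>I. indicator {0, 1} (left_lim X (real_of_ereal (Tn n \<omega>)) \<omega>) *
    indicator {real_of_ereal (Tn n \<omega>)..} t)"
proof -
  have fin: "finite I" unfolding I_def by (rule point_times_cell(3)[OF mpp])
  have *: "Tn n \<omega> \<le> ereal (max 0 (min t T)) \<longleftrightarrow> real_of_ereal (Tn n \<omega>) \<le> t" if n: "n \<in> I" for n
  proof -
    have "Tn n \<omega> \<le> ereal T" "Tn 0 \<omega> < Tn n \<omega>"
      using n point_times_less[OF mpp, of 0 n] marked_point_processD(1)[OF mpp] by (auto simp: I_def)
    then show ?thesis using marked_point_processD(1)[OF mpp] by (cases "Tn n \<omega>") (auto simp: le_max_iff_disj)
  qed
  have sub: "{n. 1 \<le> n \<and> Tn n \<omega> \<le> ereal (max 0 (min t T))} = {n\<in>I. real_of_ereal (Tn n \<omega>) \<le> t}"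
  proof -
    have "Tn n \<omega> \<le> ereal T" if "Tn n \<omega> \<le> ereal (max 0 (min t T))" for n
      using order_trans[OF that, of "ereal T"] \<open>0 < T\<close> by simp
    then show ?thesis using * by (auto simp: I_def)
  qed
  show ?thesis
    unfolding p_star_def sub using fin
    by (intro sum.mono_neutral_cong_left) (auto simp: indicator_def)
qed

lemma step_functions_stieltjes:
  fixes c a :: "nat \<Rightarrow> real"
  assumes fin: "finite I" and nonneg: "\<And>n. n \<in> I \<Longrightarrow> 0 \<le> c n"
  defines "p \<equiv> \<lambda>t. \<Sum>n\<in>I. c n * indicator {a n..} t"
  shows "x \<le> y \<Longrightarrow> p x \<le> p y" "continuous (at_right s) p"
    "(p \<longlongrightarrow> p s - (\<Sum>n\<in>I. c n * indicator {a n} s)) (at_left s)"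
proof -
  show "p x \<le> p y" if "x \<le> y"
    unfolding p_def using that nonneg by (intro sum_mono mult_left_mono) (auto simp: indicator_def)
  have "((indicator {a n..} :: real \<Rightarrow> real) \<longlongrightarrow> indicator {a n..} s) (at_right s)" for n
  proof (rule tendsto_eventually, cases "a n \<le> s")
    case True
    then show "\<forall>\<^sub>F t in at_right s. indicator {a n..} t = (indicator {a n..} s :: real)"
      unfolding eventually_at_right_field by (intro exI[of _ "s + 1"]) (auto simp: indicator_def)
  next
    case False
    then show "\<forall>\<^sub>F t in at_right s. indicator {a n..} t = (indicator {a n..} s :: real)"
      unfolding eventually_at_right_field by (intro exI[of _ "a n"]) (auto simp: indicator_def)
  qed
  then show "continuous (at_right s) p"
    unfolding p_def continuous_within by (intro tendsto_intros)
  have "((indicator {a n..} :: real \<Rightarrow> real) \<longlongrightarrow> indicator {a n..} s - indicator {a n} s) (at_left s)" for n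
  proof (rule tendsto_eventually, cases "a n < s")
    case True
    then show "\<forall>\<^sub>F t in at_left s. indicator {a n..} t = (indicator {a n..} s - indicator {a n} s :: real)"
      unfolding eventually_at_left_field by (intro exI[of _ "a n"]) (auto simp: indicator_def)
  next
    case False
    then show "\<forall>\<^sub>F t in at_left s. indicator {a n..} t = (indicator {a n..} s - indicator {a n} s :: real)"
      unfolding eventually_at_left_field by (intro exI[of _ "s - 1"]) (auto simp: indicator_def)
  qed
  then have "(p \<longlongrightarrow> (\<Sum>n\<in>I. c n * (indicator {a n..} s - indicator {a n} s))) (at_left s)"
    unfolding p_def by (intro tendsto_intros)
  then show "(p \<longlongrightarrow> p s - (\<Sum>n\<in>I. c n * indicator {a n} s)) (at_left s)"
    unfolding p_def by (simp add: right_diff_distrib sum_subtractf)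
qed

text \<open>The points are distinct and the left limit meets the boundary at points only, so exactly one
  step is located at a time \<open>s\<close> with \<open>X\<^sub>s\<^sub>- \<in> {0,1}\<close>, with height 1, and the steps located at any other time have height 0.\<close>

lemma interval_measure_p_star:
  assumes X: "pdmp M F T h lam Q \<Phi> Tn \<zeta> X" and \<omega>: "\<omega> \<in> space M" and "0 < T"
  defines "p \<equiv> \<lambda>t. p_star Tn X (max 0 (min t T)) \<omega>"
  shows "\<And>x y. x \<le> y \<Longrightarrow> p x \<le> p y" "\<And>s. continuous (at_right s) p"
    "\<And>s. s \<in> {0<..T} \<Longrightarrow> emeasure (interval_measure p) {s} = indicator {0, 1} (left_lim X s \<omega>)"
proof -
  note mpp = pdmpD(2)[OF X] \<omega>
  define I where "I = {n. 1 \<le> n \<and> Tn n \<omega> \<le> ereal T}"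
  define a where "a n = real_of_ereal (Tn n \<omega>)" for n
  define c where "c n = (indicator {0, 1} (left_lim X (a n) \<omega>) :: real)" for n
  have p: "p = (\<lambda>t. \<Sum>n\<in>I. c n * indicator {a n..} t)"
    unfolding p_def c_def a_def I_def by (rule ext, rule p_star_eq_sum[OF mpp \<open>0 < T\<close>])
  have fin: "finite I" unfolding I_def by (rule point_times_cell(3)[OF mpp])
  have c0: "0 \<le> c n" for n by (simp add: c_def)
  have step: "\<And>x y. x \<le> y \<Longrightarrow> p x \<le> p y" "\<And>s. continuous (at_right s) p"
    "\<And>s. (p \<longlongrightarrow> p s - (\<Sum>n\<in>I. c n * indicator {a n} s)) (at_left s)"
    unfolding p by (rule step_functions_stieltjes[OF fin c0]; assumption?)+
  show mono: "p x \<le> p y" if "x \<le> y" for x y using step(1) that by simp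
  show cont: "continuous (at_right s) p" for s by (rule step(2))
  fix s assume s: "s \<in> {0<..T}"
  have "(\<Sum>n\<in>I. c n * indicator {a n} s) = (indicator {0, 1} (left_lim X s \<omega>) :: real)"
  proof (cases "\<exists>n\<in>I. a n = s")
    case True
    then obtain n where n: "n \<in> I" "a n = s" by blast
    have Tn: "Tn m \<omega> = ereal (a m)" if "m \<in> I" for m
    proof -
      from that have "Tn m \<omega> \<le> ereal T" by (simp add: I_def)
      then show ?thesis by (rule point_time_finite[OF mpp]) (simp add: a_def)
    qed
    have uniq: "m = n" if "m \<in> I" "a m = s" for m
    proof (rule ccontr)
      assume "m \<noteq> n"
      then consider "m < n" | "n < m" by linarith
      moreover have "Tn m \<omega> = ereal s" "Tn n \<omega> = ereal s" using Tn[of m] Tn[of n] that n by simp_all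
      ultimately show False
        using point_times_less[OF mpp, of m n] point_times_less[OF mpp, of n m] by cases simp_all
    qed
    have "(\<Sum>m\<in>I. c m * indicator {a m} s) = (\<Sum>m\<in>{n}. c m * indicator {a m} s)"
    proof (rule sum.mono_neutral_right[OF fin])
      show "\<forall>m\<in>I - {n}. c m * indicator {a m} s = 0"
      proof
        fix m assume "m \<in> I - {n}"
        with uniq[of m] have "a m \<noteq> s" by blast
        then show "c m * indicator {a m} s = 0" by simp
      qed
    qed (use n in simp)
    then show ?thesis using n by (simp add: c_def)
  next
    case False
    have "left_lim X s \<omega> \<notin> {0, 1}"
    proof
      assume "left_lim X s \<omega> \<in> {0, 1}"
      then obtain n where "1 \<le> n" "Tn n \<omega> = ereal s" using pdmp_boundary_only_at_points[OF X \<omega> s] by blast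
      then have "n \<in> I" "a n = s" using s by (simp_all add: I_def a_def)
      then show False using False by blast
    qed
    then show ?thesis using False by (auto intro!: sum.neutral simp: indicator_def)
  qed
  then show "emeasure (interval_measure p) {s} = indicator {0, 1} (left_lim X s \<omega>)"
    using emeasure_interval_measure_singleton[of p, OF mono cont step(3), of s] by (simp add: ennreal_indicator)
qed

lemma pdmp_left_lim_measurable:
  assumes fps: "filtered_prob_space M F T" and X: "pdmp M F T h lam Q \<Phi> Tn \<zeta> X" and \<omega>: "\<omega> \<in> space M"
  shows "(\<lambda>s. left_lim X s \<omega>) \<in> borel_measurable (restrict_space borel {0..T})"
  using measurable_compose[OF measurable_predictable_section[OF fps \<omega>]
      predictable_left_lim[OF fps pdmpD(3)[OF X] pdmpD(4)[OF X]]] by simp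

text \<open>The rate is measurable on the open interval only; since it vanishes at the two boundary points,
  it agrees on \<open>[0,1]\<close> with its extension by zero, which is Borel on the line.\<close>

lemma pdmp_jump_rate_integrable:
  assumes fps: "filtered_prob_space M F T" and X: "pdmp M F T h lam Q \<Phi> Tn \<zeta> X" and \<omega>: "\<omega> \<in> space M"
  defines "l \<equiv> \<lambda>s. indicator {0<..T} s * lam (left_lim X s \<omega>)"
  shows "l \<in> borel_measurable borel" "\<And>s. 0 \<le> l s" "integrable lborel l"
proof -
  have lc: "lam \<in> borel_measurable (restrict_space borel {0<..<1})" "lam 0 = 0" "lam 1 = 0"
    "\<exists>C. \<forall>y\<in>{0<..<1}. 0 \<le> lam y \<and> lam y \<le> C"
    using pdmpD(1)[OF X] by (auto simp: local_characteristics_def)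
  then obtain C where C: "\<And>y. y \<in> {0<..<1} \<Longrightarrow> 0 \<le> lam y" "\<And>y. y \<in> {0<..<1} \<Longrightarrow> lam y \<le> C" by blast
  have [measurable]: "(\<lambda>y. indicator {0<..<1} y * lam y) \<in> borel_measurable borel"
    using lc(1) by (subst (asm) borel_measurable_restrict_space_iff) auto
  have l: "l s = indicator {0<..T} s * (indicator {0<..<1} (left_lim X s \<omega>) * lam (left_lim X s \<omega>))" for s
  proof (cases "s \<in> {0<..T}")
    case True
    then have "left_lim X s \<omega> \<in> {0..1}" using pdmp_left_lim_range[OF X \<omega>, of s] by simp
    then show ?thesis using lc(2,3) unfolding l_def by (cases "left_lim X s \<omega> = 0 \<or> left_lim X s \<omega> = 1") auto
  qed (simp add: l_def)
  have "(\<lambda>s. indicator {0..T} s *\<^sub>R (indicator {0<..<1} (left_lim X s \<omega>) * lam (left_lim X s \<omega>))) \<in> borel_measurable borel"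
    using measurable_compose[OF pdmp_left_lim_measurable[OF fps X \<omega>]
        \<open>(\<lambda>y. indicator {0<..<1} y * lam y) \<in> borel_measurable borel\<close>]
    by (subst (asm) borel_measurable_restrict_space_iff) auto
  then have "(\<lambda>s. indicator {0<..T} s * (indicator {0..T} s *\<^sub>R (indicator {0<..<1} (left_lim X s \<omega>) * lam (left_lim X s \<omega>)))) \<in> borel_measurable borel"
    by measurable
  also have "(\<lambda>s. indicator {0<..T} s * (indicator {0..T} s *\<^sub>R (indicator {0<..<1} (left_lim X s \<omega>) * lam (left_lim X s \<omega>)))) = l"
    by (auto simp: l indicator_def)
  finally show meas: "l \<in> borel_measurable borel" .
  show nonneg: "0 \<le> l s" for s using C(1) by (auto simp: l indicator_def)
  show "integrable lborel l"
  proof (rule Bochner_Integration.integrable_bound)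
    show "integrable lborel (\<lambda>s. indicator {0<..T} s * C)"
      using filtered_prob_spaceD(1)[OF fps] by (intro integrable_mult_left integrable_real_indicator) auto
    show "AE s in lborel. norm (l s) \<le> norm (indicator {0<..T} s * C)"
      using C by (intro AE_I2) (force simp: l indicator_def)
  qed (use meas in simp)
qed

lemma interval_measure_A_process:
  assumes fps: "filtered_prob_space M F T" and X: "pdmp M F T h lam Q \<Phi> Tn \<zeta> X" and \<omega>: "\<omega> \<in> space M"
  shows "B \<in> sets borel \<Longrightarrow> emeasure (interval_measure (\<lambda>t. A_process lam Tn X (max 0 (min t T)) \<omega>)) B =
      emeasure (density lborel (\<lambda>s. ennreal (indicator {0<..T} s * lam (left_lim X s \<omega>)))) B +
      emeasure (interval_measure (\<lambda>t. p_star Tn X (max 0 (min t T)) \<omega>)) B"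
    "s \<in> {0<..T} \<Longrightarrow> emeasure (interval_measure (\<lambda>t. A_process lam Tn X (max 0 (min t T)) \<omega>)) {s} =
      indicator {0, 1} (left_lim X s \<omega>)"
proof -
  define l where "l = (\<lambda>s. indicator {0<..T} s * lam (left_lim X s \<omega>))"
  define L where "L = (\<lambda>t. LBINT s:{..t}. l s)"
  define p where "p = (\<lambda>t. p_star Tn X (max 0 (min t T)) \<omega>)"
  have T: "0 < T" by (rule filtered_prob_spaceD(1)[OF fps])
  have p: "\<And>x y. x \<le> y \<Longrightarrow> p x \<le> p y" "\<And>s. continuous (at_right s) p"
    "\<And>s. s \<in> {0<..T} \<Longrightarrow> emeasure (interval_measure p) {s} = indicator {0, 1} (left_lim X s \<omega>)"
    unfolding p_def by (rule interval_measure_p_star[OF X \<omega> T]; assumption)+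
  have l: "l \<in> borel_measurable borel" "\<And>s. 0 \<le> l s" "integrable lborel l"
    unfolding l_def by (rule pdmp_jump_rate_integrable[OF fps X \<omega>])+
  have L: "\<And>x y. x \<le> y \<Longrightarrow> L x \<le> L y" "continuous_on UNIV L"
    "interval_measure L = density lborel (\<lambda>s. ennreal (l s))"
    unfolding L_def by (rule interval_measure_integral[OF l]; assumption?)+
  have Lc: "continuous (at_right a) L" for a
    using L(2) by (auto simp: continuous_on_eq_continuous_within intro: continuous_within_subset)
  have "A_process lam Tn X (max 0 (min t T)) \<omega> = L t + p t" for t
  proof -
    have "indicator {0<..max 0 (min t T)} s *\<^sub>R lam (left_lim X s \<omega>) = indicator {..t} s *\<^sub>R l s" for s
      by (auto simp: l_def indicator_def)
    then show ?thesis by (simp add: A_process_def p_def L_def set_lebesgue_integral_def)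
  qed
  then have eq: "emeasure (interval_measure (\<lambda>t. A_process lam Tn X (max 0 (min t T)) \<omega>)) B =
      emeasure (density lborel l) B + emeasure (interval_measure p) B" if "B \<in> sets borel" for B
    using emeasure_interval_measure_add[OF L(1) Lc p(1,2) that] by (simp add: L(3))
  then show "emeasure (interval_measure (\<lambda>t. A_process lam Tn X (max 0 (min t T)) \<omega>)) B =
      emeasure (density lborel (\<lambda>s. ennreal (indicator {0<..T} s * lam (left_lim X s \<omega>)))) B +
      emeasure (interval_measure (\<lambda>t. p_star Tn X (max 0 (min t T)) \<omega>)) B" if "B \<in> sets borel"
    using that by (simp add: p_def l_def)
  show "emeasure (interval_measure (\<lambda>t. A_process lam Tn X (max 0 (min t T)) \<omega>)) {s} =
      indicator {0, 1} (left_lim X s \<omega>)" if "s \<in> {0<..T}"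
  proof -
    have "emeasure (density lborel l) {s} = 0"
      using l(1) AE_lborel_singleton[of s]
      by (subst emeasure_density) (auto simp: nn_integral_0_iff_AE indicator_def elim!: eventually_mono)
    then show ?thesis using eq[of "{s}"] p(3)[OF that] by simp
  qed
qed

section \<open>Random measures given by a kernel\<close>

text \<open>The law \<open>Q(X\<^sub>s\<^sub>-,dx)\<close> at \<open>z = (\<omega>,s)\<close>, carried from \<open>]-1,1[\<close> to the Borel sets of the line,
  where the integrands are defined.\<close>

definition jump_law :: "(real \<Rightarrow> real measure) \<Rightarrow> (real \<Rightarrow> 'a \<Rightarrow> real) \<Rightarrow> 'a \<times> real \<Rightarrow> real measure" where
  "jump_law Q X z = distr (Q (left_lim X (snd z) (fst z))) borel (\<lambda>x. x)"

lemma jump_law_kernel: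
  assumes fps: "filtered_prob_space M F T" and X: "pdmp M F T h lam Q \<Phi> Tn \<zeta> X"
  shows "jump_law Q X \<in> measurable (predictable_sigma M F T) (prob_algebra borel)"
proof -
  have "(\<lambda>z. left_lim X (snd z) (fst z)) \<in> measurable (predictable_sigma M F T) (restrict_space borel {0..1})"
    using predictable_left_lim[OF fps pdmpD(3,4)[OF X]] pdmp_left_lim_range[OF X]
    by (intro measurable_restrict_space2) (auto simp: space_predictable_sigma[OF fps])
  moreover have "Q \<in> measurable (restrict_space borel {0..1}) (prob_algebra (restrict_space borel {-1<..<1}))"
    using pdmpD(1)[OF X] by (simp add: local_characteristics_def)
  moreover have "(\<lambda>x. x) \<in> measurable (restrict_space borel {-1<..<1::real}) borel"
    by (rule measurable_restrict_space1) simp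
  ultimately show ?thesis
    unfolding jump_law_def[abs_def]
    using measurable_compose[OF measurable_compose measurable_distr_prob_space] by blast
qed

lemma jump_law_prob_space:
  assumes fps: "filtered_prob_space M F T" and X: "pdmp M F T h lam Q \<Phi> Tn \<zeta> X"
    and "\<omega> \<in> space M" "s \<in> {0..T}"
  shows "prob_space (jump_law Q X (\<omega>, s))" "sets (jump_law Q X (\<omega>, s)) = sets borel"
  using measurable_space[OF jump_law_kernel[OF fps X], of "(\<omega>, s)"] assms(3,4)
  by (auto simp: space_predictable_sigma[OF fps] space_prob_algebra)

text \<open>Brings the kernel to a form in which it is the image of \<open>jump_law\<close>, a measurable function of
  \<open>(\<omega>,s)\<close>; this gives the measurability in \<open>s\<close> without which \<open>bind\<close> cannot be evaluated.\<close>

lemma kernel_measure_kernel: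
  assumes fps: "filtered_prob_space M F T" and X: "pdmp M F T h lam Q \<Phi> Tn \<zeta> X"
    and \<omega>: "\<omega> \<in> space M" and s: "s \<in> {0..T}"
  shows "distr (Q (left_lim X s \<omega>)) borel (\<lambda>x. (s, x)) = distr (jump_law Q X (\<omega>, s)) borel (\<lambda>x. (s, x))"
proof -
  have "Q (left_lim X s \<omega>) \<in> space (prob_algebra (restrict_space borel {-1<..<1}))"
    using pdmpD(1)[OF X] pdmp_left_lim_range[OF X \<omega> s]
    by (intro measurable_space[of Q "restrict_space borel {0..1}"]) (auto simp: local_characteristics_def space_restrict_space)
  then have "sets (Q (left_lim X s \<omega>)) = sets (restrict_space borel {-1<..<1})" by (simp add: space_prob_algebra)
  then have [simp]: "measurable (Q (left_lim X s \<omega>)) borel = measurable (restrict_space borel {-1<..<1}) (borel :: real measure)"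
    by (rule measurable_cong_sets) simp
  have "(\<lambda>x. x) \<in> measurable (restrict_space borel {-1<..<1::real}) borel"
    by (rule measurable_restrict_space1) simp
  then show ?thesis unfolding jump_law_def by (subst distr_distr) (auto simp: comp_def)
qed

lemma emeasure_kernel_measure:
  assumes fps: "filtered_prob_space M F T" and X: "pdmp M F T h lam Q \<Phi> Tn \<zeta> X"
    and \<omega>: "\<omega> \<in> space M" and K: "sets (K \<omega>) = sets (restrict_space borel {0<..T})"
  shows "sets (kernel_measure K Q X \<omega>) = sets borel"
    "B \<in> sets borel \<Longrightarrow> (\<lambda>s. emeasure (jump_law Q X (\<omega>, s)) {x. (s, x) \<in> B}) \<in> borel_measurable (K \<omega>)"
    "B \<in> sets borel \<Longrightarrow> emeasure (kernel_measure K Q X \<omega>) B =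
      (\<integral>\<^sup>+s. emeasure (jump_law Q X (\<omega>, s)) {x. (s, x) \<in> B} \<partial>K \<omega>)"
proof -
  have spK: "space (K \<omega>) = {0<..T}" using sets_eq_imp_space_eq[OF K] by (simp add: space_restrict_space)
  have ne: "space (K \<omega>) \<noteq> {}" using filtered_prob_spaceD(1)[OF fps] by (auto simp: spK)
  have law: "(\<lambda>s. jump_law Q X (\<omega>, s)) \<in> measurable (K \<omega>) (subprob_algebra borel)"
  proof -
    have "(\<lambda>s. s) \<in> measurable (K \<omega>) (restrict_space borel {0..T})"
    proof -
      have "(\<lambda>s. s) \<in> measurable (restrict_space borel {0<..T}) (restrict_space borel {0..T})"
        by (rule measurable_restrict_space3) auto
      then show ?thesis by (simp cong: measurable_cong_sets add: K)
    qed
    from measurable_compose[OF measurable_compose[OF this measurable_predictable_section[OF fps \<omega>]]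
        measurable_prob_algebraD[OF jump_law_kernel[OF fps X]]]
    show ?thesis .
  qed
  have id: "(\<lambda>s. s) \<in> borel_measurable (K \<omega>)"
    by (simp cong: measurable_cong_sets add: K measurable_restrict_space1)
  have k: "(\<lambda>s. distr (jump_law Q X (\<omega>, s)) borel (\<lambda>x. (s, x))) \<in> measurable (K \<omega>) (subprob_algebra borel)"
  proof (rule measurable_distr2[OF _ law])
    have "(\<lambda>z. (fst z, snd z)) \<in> borel_measurable (K \<omega> \<Otimes>\<^sub>M (borel :: real measure))"
      by (rule borel_measurable_Pair[OF measurable_compose[OF measurable_fst id] measurable_snd])
    then show "(\<lambda>(s, x). (s, x)) \<in> borel_measurable (K \<omega> \<Otimes>\<^sub>M (borel :: real measure))" by (simp add: case_prod_unfold)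
  qed
  have eq: "kernel_measure K Q X \<omega> = K \<omega> \<bind> (\<lambda>s. distr (jump_law Q X (\<omega>, s)) borel (\<lambda>x. (s, x)))"
    unfolding kernel_measure_def
    by (rule bind_cong) (auto simp: spK intro!: kernel_measure_kernel[OF fps X \<omega>])
  show "sets (kernel_measure K Q X \<omega>) = sets borel"
    unfolding eq by (rule sets_bind) (auto simp: ne)
  assume B: "B \<in> sets borel"
  have em: "emeasure (distr (jump_law Q X (\<omega>, s)) borel (\<lambda>x. (s, x))) B = emeasure (jump_law Q X (\<omega>, s)) {x. (s, x) \<in> B}"
    if "s \<in> space (K \<omega>)" for s
  proof -
    have "(\<lambda>x. (s, x)) \<in> borel_measurable (jump_law Q X (\<omega>, s))"
      using jump_law_prob_space(2)[OF fps X \<omega>, of s] that by (simp cong: measurable_cong_sets add: spK)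
    moreover have "space (jump_law Q X (\<omega>, s)) = UNIV" by (simp add: jump_law_def)
    ultimately show ?thesis using B by (subst emeasure_distr) (auto simp: vimage_def)
  qed
  show "emeasure (kernel_measure K Q X \<omega>) B = (\<integral>\<^sup>+s. emeasure (jump_law Q X (\<omega>, s)) {x. (s, x) \<in> B} \<partial>K \<omega>)"
    unfolding eq using em by (subst emeasure_bind[OF ne k B]) (rule nn_integral_cong)
  show "(\<lambda>s. emeasure (jump_law Q X (\<omega>, s)) {x. (s, x) \<in> B}) \<in> borel_measurable (K \<omega>)"
    using measurable_emeasure_kernel[OF k B] em by (simp cong: measurable_cong)
qed

lemma measurable_predictable_tilde_section:
  assumes fps: "filtered_prob_space M F T" and \<omega>: "\<omega> \<in> space M"
  shows "(\<lambda>z. ((\<omega>, fst z), snd z)) \<in> measurable (restrict_space borel ({0..T} \<times> UNIV)) (predictable_sigma_tilde M F T)"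
  unfolding predictable_sigma_tilde_def
proof (rule measurable_Pair)
  have "fst \<in> measurable (restrict_space borel ({0..T} \<times> (UNIV::real set))) (restrict_space borel {0..T::real})"
    by (rule measurable_restrict_space3) (auto simp: borel_prod[symmetric])
  from measurable_compose[OF this measurable_predictable_section[OF fps \<omega>]]
  show "(\<lambda>z. (\<omega>, fst z)) \<in> measurable (restrict_space borel ({0..T} \<times> (UNIV::real set))) (predictable_sigma M F T)" .
  show "snd \<in> measurable (restrict_space borel ({0..T} \<times> (UNIV::real set))) (borel::real measure)"
    by (rule measurable_restrict_space1) (simp add: borel_prod[symmetric])
qed

lemma predictable_tilde_section_sets:
  assumes fps: "filtered_prob_space M F T" and \<omega>: "\<omega> \<in> space M" and B: "B \<in> sets (predictable_sigma_tilde M F T)"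
  shows "{z. ((\<omega>, fst z), snd z) \<in> B} \<in> sets borel"
proof -
  have "B \<subseteq> (space M \<times> {0..T}) \<times> UNIV"
    using sets.sets_into_space[OF B] by (simp add: predictable_sigma_tilde_def space_pair_measure space_predictable_sigma[OF fps])
  then have eq: "{z. ((\<omega>, fst z), snd z) \<in> B} = (\<lambda>z. ((\<omega>, fst z), snd z)) -` B \<inter> space (restrict_space borel ({0..T} \<times> UNIV))"
    by (auto simp: space_restrict_space)
  have "{0..T} \<times> (UNIV::real set) \<in> sets borel" by (simp add: borel_prod[symmetric])
  then show ?thesis
    using measurable_sets[OF measurable_predictable_tilde_section[OF fps \<omega>] B] unfolding eq
    by (simp add: sets_restrict_space_iff)
qed

lemma rm_integral_indicator:
  assumes fps: "filtered_prob_space M F T" and \<omega>: "\<omega> \<in> space M" and B: "B \<in> sets (predictable_sigma_tilde M F T)"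
    and \<eta>: "sets (\<eta> \<omega>) = sets borel"
  shows "rm_integral \<eta> (indicator B) T \<omega> = emeasure (\<eta> \<omega>) ({z. ((\<omega>, fst z), snd z) \<in> B} \<inter> {0<..T} \<times> UNIV)"
proof -
  have "{0<..T} \<times> (UNIV::real set) \<in> sets borel" by (simp add: borel_prod[symmetric])
  then have "{z. ((\<omega>, fst z), snd z) \<in> B} \<inter> {0<..T} \<times> UNIV \<in> sets (\<eta> \<omega>)"
    using predictable_tilde_section_sets[OF fps \<omega> B] by (simp add: \<eta>)
  then have "emeasure (\<eta> \<omega>) ({z. ((\<omega>, fst z), snd z) \<in> B} \<inter> {0<..T} \<times> UNIV) =
    (\<integral>\<^sup>+z. indicator ({z. ((\<omega>, fst z), snd z) \<in> B} \<inter> {0<..T} \<times> UNIV) z \<partial>\<eta> \<omega>)" by simp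
  then show ?thesis unfolding rm_integral_def
    by (simp only:) (auto intro!: nn_integral_cong simp: indicator_def)
qed

lemma rm_integral_jump_measure_null:
  assumes fps: "filtered_prob_space M F T" and \<omega>: "\<omega> \<in> space M" and B: "B \<in> sets (predictable_sigma_tilde M F T)"
    and null: "\<And>s. s \<in> {0<..T} \<Longrightarrow> jump X s \<omega> \<noteq> 0 \<Longrightarrow> ((\<omega>, s), jump X s \<omega>) \<notin> B"
  shows "rm_integral (jump_measure T X) (indicator B) T \<omega> = 0"
proof -
  have s: "sets (jump_measure T X \<omega>) = sets borel" by (simp add: jump_measure_def)
  have "{z. ((\<omega>, fst z), snd z) \<in> B} \<inter> {0<..T} \<times> UNIV \<in> sets borel"
    using predictable_tilde_section_sets[OF fps \<omega> B] by (auto simp: borel_prod[symmetric])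
  then have "emeasure (jump_measure T X \<omega>) ({z. ((\<omega>, fst z), snd z) \<in> B} \<inter> {0<..T} \<times> UNIV) =
    emeasure (count_space {s\<in>{0<..T}. jump X s \<omega> \<noteq> 0})
      ((\<lambda>s. (s, jump X s \<omega>)) -` ({z. ((\<omega>, fst z), snd z) \<in> B} \<inter> {0<..T} \<times> UNIV) \<inter> {s\<in>{0<..T}. jump X s \<omega> \<noteq> 0})"
    unfolding jump_measure_def by (subst emeasure_distr) simp_all
  also have "(\<lambda>s. (s, jump X s \<omega>)) -` ({z. ((\<omega>, fst z), snd z) \<in> B} \<inter> {0<..T} \<times> UNIV) \<inter> {s\<in>{0<..T}. jump X s \<omega> \<noteq> 0} = {}"
    using null by fastforce
  finally have "emeasure (jump_measure T X \<omega>) ({z. ((\<omega>, fst z), snd z) \<in> B} \<inter> {0<..T} \<times> UNIV) = 0" by simp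
  then show ?thesis by (simp add: rm_integral_indicator[where \<eta>="jump_measure T X", OF fps \<omega> B s])
qed

text \<open>The compensator identity is applied to the indicator of \<open>B\<close>, which turns an almost sure zero for
  \<open>\<mu>\<close> into a zero expectation for \<open>\<nu>\<close>. Predictability of the \<open>\<nu>\<close>-integral, read at time \<open>T\<close>, provides the
  measurability in \<open>\<omega>\<close> that turns the zero expectation into an almost sure zero.\<close>

lemma compensator_null:
  assumes fps: "filtered_prob_space M F T" and comp: "compensator M F T \<mu> \<nu>"
    and B: "B \<in> sets (predictable_sigma_tilde M F T)"
    and null: "AE \<omega> in M. rm_integral \<mu> (indicator B) T \<omega> = 0"
  shows "AE \<omega> in M. rm_integral \<nu> (indicator B) T \<omega> = 0"
proof -
  have W: "indicator B \<in> borel_measurable (predictable_sigma_tilde M F T)" using B by simp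
  have "(\<integral>\<^sup>+\<omega>. rm_integral \<nu> (indicator B) T \<omega> \<partial>M) = (\<integral>\<^sup>+\<omega>. rm_integral \<mu> (indicator B) T \<omega> \<partial>M)"
    using comp W unfolding compensator_def by auto
  also have "\<dots> = (\<integral>\<^sup>+\<omega>. 0 \<partial>M)" using null by (rule nn_integral_cong_AE)
  finally have "(\<integral>\<^sup>+\<omega>. rm_integral \<nu> (indicator B) T \<omega> \<partial>M) = 0" by simp
  moreover have "predictable M F T (rm_integral \<nu> (indicator B))" using comp W unfolding compensator_def by auto
  then have "rm_integral \<nu> (indicator B) T \<in> borel_measurable M"
    using measurable_compose[OF measurable_predictable_terminal[OF fps],
        of "\<lambda>(\<omega>, s). rm_integral \<nu> (indicator B) s \<omega>" borel] by (simp add: predictable_def)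
  ultimately show ?thesis by (simp add: nn_integral_0_iff_AE)
qed

section \<open>Atoms of the compensator\<close>

lemma sets_stieltjes: "sets (stieltjes T V \<omega>) = sets (restrict_space borel {0<..T})"
  unfolding stieltjes_def by (rule sets_restrict_space_cong) simp

lemma emeasure_stieltjes:
  assumes "B \<subseteq> {0<..T}"
  shows "emeasure (stieltjes T V \<omega>) B = emeasure (interval_measure (\<lambda>t. V (max 0 (min t T)) \<omega>)) B"
  unfolding stieltjes_def using assms by (subst emeasure_restrict_space) auto

lemma A_process_atom:
  assumes fps: "filtered_prob_space M F T" and X: "pdmp M F T h lam Q \<Phi> Tn \<zeta> X" and \<omega>: "\<omega> \<in> space M"
    and s: "s \<in> {0<..T}"
  shows "emeasure (stieltjes T (A_process lam Tn X) \<omega>) {s} = indicator {0, 1} (left_lim X s \<omega>)"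
  using interval_measure_A_process(2)[OF fps X \<omega> s] s by (subst emeasure_stieltjes) auto

text \<open>The measure \<open>\<nu>({s}, dx)\<close> is \<open>Q(X\<^sub>s\<^sub>-,dx)\<close> times the mass that \<open>dA\<close> puts on \<open>s\<close>, and that mass is 1
  on the boundary and 0 inside. In particular \<open>\<nu>({s} \<times> \<real>)\<close> only takes the values 0 and 1.\<close>

lemma pdmp_compensator_section:
  assumes fps: "filtered_prob_space M F T" and X: "pdmp M F T h lam Q \<Phi> Tn \<zeta> X" and \<omega>: "\<omega> \<in> space M"
    and s: "s \<in> {0<..T}" and B: "B \<in> sets borel"
  shows "emeasure (pdmp_compensator T lam Q Tn X \<omega>) (B \<inter> {s} \<times> UNIV) =
    emeasure (jump_law Q X (\<omega>, s)) {x. (s, x) \<in> B} * indicator {0, 1} (left_lim X s \<omega>)"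
proof -
  let ?K = "stieltjes T (A_process lam Tn X)"
  have B': "B \<inter> {s} \<times> UNIV \<in> sets borel" using B by (auto simp: borel_prod[symmetric])
  have "emeasure (pdmp_compensator T lam Q Tn X \<omega>) (B \<inter> {s} \<times> UNIV) =
    (\<integral>\<^sup>+t. emeasure (jump_law Q X (\<omega>, t)) {x. (t, x) \<in> B \<inter> {s} \<times> UNIV} \<partial>?K \<omega>)"
    unfolding pdmp_compensator_def by (rule emeasure_kernel_measure(3)[OF fps X \<omega> sets_stieltjes B'])
  also have "\<dots> = (\<integral>\<^sup>+t. emeasure (jump_law Q X (\<omega>, s)) {x. (s, x) \<in> B} * indicator {s} t \<partial>?K \<omega>)"
    by (intro nn_integral_cong) (auto simp: indicator_def)
  also have "\<dots> = emeasure (jump_law Q X (\<omega>, s)) {x. (s, x) \<in> B} * emeasure (?K \<omega>) {s}"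
    using s by (intro nn_integral_cmult_indicator) (auto simp: sets_stieltjes sets_restrict_space_iff)
  finally show ?thesis by (simp add: A_process_atom[OF fps X \<omega> s])
qed

lemma sets_pdmp_compensator:
  assumes fps: "filtered_prob_space M F T" and X: "pdmp M F T h lam Q \<Phi> Tn \<zeta> X" and \<omega>: "\<omega> \<in> space M"
  shows "sets (pdmp_compensator T lam Q Tn X \<omega>) = sets borel"
  unfolding pdmp_compensator_def by (rule emeasure_kernel_measure(1)[OF fps X \<omega> sets_stieltjes])

text \<open>Only the values of the integrand on \<open>{s} \<times> \<real>\<close> matter, so it may be replaced by \<open>w s\<close> as a function of
  the second coordinate, which is Borel on \<open>\<real> \<times> \<real>\<close>.\<close>

lemma pdmp_compensator_section_integral:
  fixes w :: "real \<Rightarrow> real \<Rightarrow> real"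
  assumes fps: "filtered_prob_space M F T" and X: "pdmp M F T h lam Q \<Phi> Tn \<zeta> X" and \<omega>: "\<omega> \<in> space M"
    and s: "s \<in> {0<..T}" and w: "w s \<in> borel_measurable borel"
  defines "\<nu> \<equiv> pdmp_compensator T lam Q Tn X"
  shows "set_integrable (\<nu> \<omega>) ({s} \<times> UNIV) (\<lambda>(t, x). w t x) \<longleftrightarrow>
      (left_lim X s \<omega> \<in> {0, 1} \<longrightarrow> integrable (jump_law Q X (\<omega>, s)) (w s))" (is "?L \<longleftrightarrow> ?R")
    "(LINT z:{s} \<times> UNIV|\<nu> \<omega>. (case z of (t, x) \<Rightarrow> w t x)) =
      indicator {0, 1} (left_lim X s \<omega>) * (LINT x|jump_law Q X (\<omega>, s). w s x)"
proof -
  have S: "{s} \<times> (UNIV :: real set) \<in> sets borel" by (simp add: borel_prod[symmetric])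
  have sets: "sets (\<nu> \<omega>) = sets borel" unfolding \<nu>_def by (rule sets_pdmp_compensator[OF fps X \<omega>])
  have ws: "(\<lambda>z. w s (snd z)) \<in> borel_measurable (borel :: (real \<times> real) measure)"
    unfolding borel_prod[symmetric] by (rule measurable_compose[OF measurable_snd w])
  have fun_eq: "(\<lambda>z. indicat_real ({s} \<times> UNIV) z *\<^sub>R (case z of (t, x) \<Rightarrow> w t x)) =
      (\<lambda>z. indicat_real ({s} \<times> UNIV) z *\<^sub>R w s (snd z))"
    by (auto simp: indicator_def)
  have ws': "(\<lambda>z. w s (snd z)) \<in> borel_measurable (\<nu> \<omega>)" using ws by (simp cong: measurable_cong_sets add: sets)
  have S': "indicat_real ({s} \<times> UNIV) \<in> borel_measurable (\<nu> \<omega>)"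
    using S sets by (intro borel_measurable_indicator) simp
  have "(?L \<longleftrightarrow> ?R) \<and> (LINT z:{s} \<times> UNIV|\<nu> \<omega>. (case z of (t, x) \<Rightarrow> w t x)) =
      indicator {0, 1} (left_lim X s \<omega>) * (LINT x|jump_law Q X (\<omega>, s). w s x)"
  proof (cases "left_lim X s \<omega> \<in> {0, 1}")
    case True
    have dens: "density (\<nu> \<omega>) (\<lambda>z. ennreal (indicator ({s} \<times> UNIV) z)) = distr (jump_law Q X (\<omega>, s)) borel (\<lambda>x. (s, x))"
    proof (rule measure_eqI)
      fix B assume "B \<in> sets (density (\<nu> \<omega>) (\<lambda>z. ennreal (indicator ({s} \<times> UNIV) z)))"
      then have B: "B \<in> sets borel" by (simp add: sets)
      have "emeasure (density (\<nu> \<omega>) (\<lambda>z. ennreal (indicator ({s} \<times> UNIV) z))) B = (\<integral>\<^sup>+z. indicator (B \<inter> {s} \<times> UNIV) z \<partial>\<nu> \<omega>)"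
        using B by (subst emeasure_density[OF measurable_compose[OF S' measurable_ennreal]])
          (auto simp: sets indicator_def intro!: nn_integral_cong)
      also have "\<dots> = emeasure (\<nu> \<omega>) (B \<inter> {s} \<times> UNIV)" using B S by (intro nn_integral_indicator) (simp add: sets)
      also have "\<dots> = emeasure (jump_law Q X (\<omega>, s)) {x. (s, x) \<in> B}"
        using pdmp_compensator_section[OF fps X \<omega> s B] True by (simp add: \<nu>_def)
      also have "\<dots> = emeasure (distr (jump_law Q X (\<omega>, s)) borel (\<lambda>x. (s, x))) B"
        using B by (subst emeasure_distr) (auto simp: jump_law_def vimage_def)
      finally show "emeasure (density (\<nu> \<omega>) (\<lambda>z. ennreal (indicator ({s} \<times> UNIV) z))) B =
        emeasure (distr (jump_law Q X (\<omega>, s)) borel (\<lambda>x. (s, x))) B" .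
    qed (simp add: sets)
    have pair: "(\<lambda>x. (s, x)) \<in> borel_measurable (jump_law Q X (\<omega>, s))" by (simp add: jump_law_def)
    have "?L \<longleftrightarrow> integrable (density (\<nu> \<omega>) (\<lambda>z. ennreal (indicator ({s} \<times> UNIV) z))) (\<lambda>z. w s (snd z))"
      unfolding set_integrable_def fun_eq by (rule integrable_density[OF ws' S', symmetric]) simp
    also have "\<dots> \<longleftrightarrow> integrable (jump_law Q X (\<omega>, s)) (w s)"
      unfolding dens by (subst integrable_distr_eq[OF pair ws]) simp
    finally have 1: "?L \<longleftrightarrow> ?R" using True by auto
    have "(LINT z:{s} \<times> UNIV|\<nu> \<omega>. (case z of (t, x) \<Rightarrow> w t x)) =
      (LINT z|density (\<nu> \<omega>) (\<lambda>z. ennreal (indicator ({s} \<times> UNIV) z)). w s (snd z))"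
      unfolding set_lebesgue_integral_def fun_eq by (rule integral_density[OF ws' S', symmetric]) simp
    also have "\<dots> = (LINT x|jump_law Q X (\<omega>, s). w s x)"
      unfolding dens by (subst integral_distr[OF pair ws]) simp
    finally have 2: "(LINT z:{s} \<times> UNIV|\<nu> \<omega>. (case z of (t, x) \<Rightarrow> w t x)) =
      indicator {0, 1} (left_lim X s \<omega>) * (LINT x|jump_law Q X (\<omega>, s). w s x)" using True by simp
    show ?thesis using 1 2 by (rule conjI)
  next
    case False
    have "emeasure (\<nu> \<omega>) ({s} \<times> UNIV) = 0"
      using pdmp_compensator_section[OF fps X \<omega> s, of UNIV] False by (simp add: \<nu>_def)
    then have "AE z in \<nu> \<omega>. z \<notin> {s} \<times> UNIV"
      using S by (intro AE_not_in) (auto simp: null_sets_def sets)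
    then have ae: "AE z in \<nu> \<omega>. indicat_real ({s} \<times> UNIV) z *\<^sub>R w s (snd z) = 0" by eventually_elim auto
    have "integrable (\<nu> \<omega>) (\<lambda>z. indicat_real ({s} \<times> UNIV) z *\<^sub>R w s (snd z)) \<longleftrightarrow> integrable (\<nu> \<omega>) (\<lambda>z. 0 :: real)"
      using ws' S' ae by (intro integrable_cong_AE) auto
    then have 1: "?L \<longleftrightarrow> ?R" using False by (simp only: set_integrable_def fun_eq) simp
    have "(LINT z|\<nu> \<omega>. indicat_real ({s} \<times> UNIV) z *\<^sub>R w s (snd z)) = (LINT z|\<nu> \<omega>. 0 :: real)"
      using ws' S' ae by (intro integral_cong_AE) auto
    then show ?thesis using 1 False by (simp only: set_lebesgue_integral_def fun_eq) simp
  qed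
  then show "?L \<longleftrightarrow> ?R" "(LINT z:{s} \<times> UNIV|\<nu> \<omega>. (case z of (t, x) \<Rightarrow> w t x)) =
      indicator {0, 1} (left_lim X s \<omega>) * (LINT x|jump_law Q X (\<omega>, s). w s x)" by blast+
qed

lemma jump_measure_section_integral:
  fixes w :: "real \<Rightarrow> real \<Rightarrow> real"
  assumes s: "s \<in> {0<..T}" and w: "w s \<in> borel_measurable borel"
  shows "(LINT z:{s} \<times> UNIV|jump_measure T X \<omega>. (case z of (t, x) \<Rightarrow> w t x)) =
    (if jump X s \<omega> \<noteq> 0 then w s (jump X s \<omega>) else 0)"
proof -
  let ?S = "{s\<in>{0<..T}. jump X s \<omega> \<noteq> 0}"
  have S: "{s} \<times> (UNIV :: real set) \<in> sets borel" by (simp add: borel_prod[symmetric])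
  have ws: "(\<lambda>z. indicat_real ({s} \<times> UNIV) z *\<^sub>R w s (snd z)) \<in> borel_measurable borel"
    unfolding borel_prod[symmetric]
    by (intro borel_measurable_scaleR borel_measurable_indicator measurable_compose[OF measurable_snd w])
      (simp add: borel_prod S)
  have "(LINT z:{s} \<times> UNIV|jump_measure T X \<omega>. (case z of (t, x) \<Rightarrow> w t x)) =
    (LINT z|jump_measure T X \<omega>. indicat_real ({s} \<times> UNIV) z *\<^sub>R w s (snd z))"
    unfolding set_lebesgue_integral_def by (intro Bochner_Integration.integral_cong) (auto simp: indicator_def)
  also have "\<dots> = (LINT t|count_space ?S. indicat_real {s} t * w s (jump X t \<omega>))"
    unfolding jump_measure_def using ws by (subst integral_distr) (auto simp: indicator_def intro!: Bochner_Integration.integral_cong)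
  also have "\<dots> = (\<Sum>t | t \<in> ?S \<and> indicat_real {s} t * w s (jump X t \<omega>) \<noteq> 0. indicat_real {s} t * w s (jump X t \<omega>))"
    by (rule lebesgue_integral_count_space_finite_support) (rule finite_subset[of _ "{s}"], auto simp: indicator_def)
  also have "\<dots> = (\<Sum>t\<in>?S \<inter> {s}. indicat_real {s} t * w s (jump X t \<omega>))"
    by (rule sum.mono_neutral_left) (auto simp: indicator_def)
  also have "\<dots> = (if jump X s \<omega> \<noteq> 0 then w s (jump X s \<omega>) else 0)"
    using s by (cases "jump X s \<omega> = 0") auto
  finally show ?thesis .
qed

lemma predictable_field_section:
  assumes fps: "filtered_prob_space M F T" and "predictable_field M F T W" "\<omega> \<in> space M" "s \<in> {0..T}"
  shows "W s \<omega> \<in> borel_measurable borel"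
  using measurable_Pair2[of "\<lambda>((\<omega>, s), x). W s \<omega> x" "predictable_sigma M F T" borel borel "(\<omega>, s)"] assms(2-4)
  by (simp add: predictable_field_def predictable_sigma_tilde_def space_predictable_sigma[OF fps])

lemma W_tilde_pdmp:
  assumes fps: "filtered_prob_space M F T" and X: "pdmp M F T h lam Q \<Phi> Tn \<zeta> X" and W: "predictable_field M F T W"
    and \<omega>: "\<omega> \<in> space M" and s: "s \<in> {0<..T}"
  shows "W_tilde (jump_measure T X) (pdmp_compensator T lam Q Tn X) W s \<omega> =
    (if left_lim X s \<omega> \<in> {0, 1} \<longrightarrow> integrable (jump_law Q X (\<omega>, s)) (W s \<omega>)
     then ereal ((if jump X s \<omega> \<noteq> 0 then W s \<omega> (jump X s \<omega>) else 0) -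
       indicator {0, 1} (left_lim X s \<omega>) * (LINT x|jump_law Q X (\<omega>, s). W s \<omega> x))
     else \<infinity>)"
proof -
  have w: "W s \<omega> \<in> borel_measurable borel" using predictable_field_section[OF fps W \<omega>] s by simp
  show ?thesis
    unfolding W_tilde_def
    using pdmp_compensator_section_integral[OF fps X \<omega> s, of "\<lambda>t. W t \<omega>", OF w]
      jump_measure_section_integral[OF s, of "\<lambda>t. W t \<omega>" X \<omega>, OF w] by simp
qed

section \<open>Jumps of the backward equation\<close>

text \<open>An atom of \<open>m\<close> at \<open>s\<close> enters the tail integral as soon as its lower end lies strictly to the left of
  \<open>s\<close>. This is the only way in which the drift makes \<open>Y\<close> jump.\<close>

lemma left_limit_tail_integral:
  fixes m :: "real measure" and \<phi> :: "real \<Rightarrow> real"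
  assumes m: "sets m = sets (restrict_space borel {0<..T})" and int: "set_integrable m {0<..T} \<phi>" and s: "s \<in> {0<..T}"
  shows "((\<lambda>u. LINT r:{u<..T}|m. \<phi> r) \<longlongrightarrow> (LINT r:{s<..T}|m. \<phi> r) + \<phi> s * measure m {s}) (at_left s)"
proof -
  have meas: "{u<..T} \<in> sets m" "{s..T} \<in> sets m" "{s} \<in> sets m" if "0 \<le> u" for u
    using that s by (auto simp: m sets_restrict_space_iff)
  have spm: "space m = {0<..T}" using sets_eq_imp_space_eq[OF m] by (simp add: space_restrict_space)
  have sub: "set_integrable m B \<phi>" if "B \<in> sets m" for B
    using set_integrable_subset[OF int that] sets.sets_into_space[OF that] spm by simp
  have "(LINT r:{s<..T} \<union> {s}|m. \<phi> r) = (LINT r:{s<..T}|m. \<phi> r) + (LINT r:{s}|m. \<phi> r)"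
    using s meas by (intro set_integral_Un sub) auto
  also have "{s<..T} \<union> {s} = {s..T}" using s by auto
  also have "(LINT r:{s}|m. \<phi> r) = (LINT r:{s}|m. \<phi> s)"
    unfolding set_lebesgue_integral_def by (intro Bochner_Integration.integral_cong) (auto simp: indicator_def)
  also have "\<dots> = \<phi> s * measure m {s}" unfolding set_lebesgue_integral_def using meas(3)[of 0] spm s by simp
  finally have eq: "(LINT r:{s..T}|m. \<phi> r) = (LINT r:{s<..T}|m. \<phi> r) + \<phi> s * measure m {s}" .
  have "((\<lambda>u. LINT r:{u<..T}|m. \<phi> r) \<longlongrightarrow> (LINT r:{s..T}|m. \<phi> r)) (at_left s)"
  proof (rule tendsto_at_left_sequentially)
    show "0 < s" using s by simp
    fix u :: "nat \<Rightarrow> real" assume u: "\<And>n. u n < s" "\<And>n. 0 < u n" "u \<longlonglongrightarrow> s"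
    show "(\<lambda>n. LINT r:{u n<..T}|m. \<phi> r) \<longlonglongrightarrow> (LINT r:{s..T}|m. \<phi> r)"
      unfolding set_lebesgue_integral_def
    proof (rule integral_dominated_convergence[where w="\<lambda>r. norm (indicat_real {0<..T} r *\<^sub>R \<phi> r)"])
      show "AE r in m. (\<lambda>n. indicat_real {u n<..T} r *\<^sub>R \<phi> r) \<longlonglongrightarrow> indicat_real {s..T} r *\<^sub>R \<phi> r"
      proof (rule AE_I2)
        fix r
        show "(\<lambda>n. indicat_real {u n<..T} r *\<^sub>R \<phi> r) \<longlonglongrightarrow> indicat_real {s..T} r *\<^sub>R \<phi> r"
        proof (rule tendsto_eventually, cases "r < s")
          case True
          from order_tendstoD(1)[OF u(3) this]
          show "\<forall>\<^sub>F n in sequentially. indicat_real {u n<..T} r *\<^sub>R \<phi> r = indicat_real {s..T} r *\<^sub>R \<phi> r"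
            by eventually_elim (use True in \<open>auto simp: indicator_def\<close>)
        next
          case False
          then show "\<forall>\<^sub>F n in sequentially. indicat_real {u n<..T} r *\<^sub>R \<phi> r = indicat_real {s..T} r *\<^sub>R \<phi> r"
            using u(1) less_le_trans[of "u _" s r] by (intro always_eventually) (auto simp: indicator_def)
        qed
      qed
      show "AE r in m. norm (indicat_real {u n<..T} r *\<^sub>R \<phi> r) \<le> norm (indicat_real {0<..T} r *\<^sub>R \<phi> r)" for n
        using u(2)[of n] by (intro AE_I2) (auto simp: indicator_def)
      show "integrable m (\<lambda>r. norm (indicat_real {0<..T} r *\<^sub>R \<phi> r))"
        using int unfolding set_integrable_def by (rule integrable_norm)
      show "(\<lambda>r. indicat_real {s..T} r *\<^sub>R \<phi> r) \<in> borel_measurable m"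
        using sub[OF meas(2)[of 0]] unfolding set_integrable_def by (intro borel_measurable_integrable) simp
      show "(\<lambda>r. indicat_real {u n<..T} r *\<^sub>R \<phi> r) \<in> borel_measurable m" for n
        using sub[OF meas(1)[of "u n"]] u(2)[of n] unfolding set_integrable_def by (intro borel_measurable_integrable) simp
    qed
  qed
  then show ?thesis by (simp add: eq)
qed

lemma left_lim_continuous_image:
  assumes v: "continuous_on ({0..T} \<times> UNIV) (\<lambda>(t, x). v t x)" and cad: "cadlag M T X" and \<omega>: "\<omega> \<in> space M"
    and s: "s \<in> {0<..T}" and Y: "\<And>t. t \<in> {0..T} \<Longrightarrow> Y t \<omega> = v t (X t \<omega>)"
  shows "left_lim Y s \<omega> = v s (left_lim X s \<omega>)"
proof (rule left_lim_eqI)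
  have ev: "\<forall>\<^sub>F u in at_left s. u \<in> {0..T}"
    using s eventually_at_leftI[of 0 s "\<lambda>u. u \<in> {0..T}"] by auto
  have "((\<lambda>u. (u, X u \<omega>)) \<longlongrightarrow> (s, left_lim X s \<omega>)) (at_left s)"
    by (intro tendsto_Pair tendsto_ident_at left_lim_tendsto[OF cad \<omega> s])
  then have "((\<lambda>u. (\<lambda>(t, x). v t x) (u, X u \<omega>)) \<longlongrightarrow> (\<lambda>(t, x). v t x) (s, left_lim X s \<omega>)) (at_left s)"
    by (rule continuous_on_tendsto_compose[OF v]) (use s ev in \<open>auto elim!: eventually_mono\<close>)
  then have "((\<lambda>u. v u (X u \<omega>)) \<longlongrightarrow> v s (left_lim X s \<omega>)) (at_left s)" by simp
  then show "((\<lambda>u. Y u \<omega>) \<longlongrightarrow> v s (left_lim X s \<omega>)) (at_left s)"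
    by (rule Lim_transform_eventually) (use ev Y in \<open>auto elim!: eventually_mono\<close>)
qed (use s in simp)

text \<open>The jump of \<open>Y\<close> computed twice. As \<open>Y\<^sub>t = v(t,X\<^sub>t)\<close> with \<open>v\<close> continuous, it is the increment of \<open>v\<close>
  across the jump of \<open>X\<close>; from the equation it is the jump of the stochastic integral minus the atom of the
  drift. Compensator and drift both contribute on the boundary only, with mass 1 each.\<close>

lemma bsde_jump:
  fixes dA :: "'a \<Rightarrow> real measure"
  assumes fps: "filtered_prob_space M F T" and X: "pdmp M F T h lam Q \<Phi> Tn \<zeta> X"
    and dA: "dA = stieltjes T (A_process lam Tn X)"
    and U: "predictable_field M F T U"
    and sol: "bsde_solution M F T X dA (jump_measure T X) (pdmp_compensator T lam Q Tn X) g f Y U"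
    and v: "continuous_on ({0..T} \<times> UNIV) (\<lambda>(t, x). v t x)"
    and Y_v: "AE \<omega> in M. \<forall>t\<in>{0..T}. Y t \<omega> = v t (X t \<omega>)"
  shows "AE \<omega> in M. \<forall>s\<in>{0<..T}.
    (left_lim X s \<omega> \<in> {0, 1} \<longrightarrow> integrable (jump_law Q X (\<omega>, s)) (U s \<omega>)) \<and>
    v s (X s \<omega>) - v s (left_lim X s \<omega>) = (if jump X s \<omega> \<noteq> 0 then U s \<omega> (jump X s \<omega>) else 0) -
      indicator {0, 1} (left_lim X s \<omega>) *
      ((LINT x|jump_law Q X (\<omega>, s). U s \<omega> x) + f s (left_lim X s \<omega>) (left_lim Y s \<omega>) (U s \<omega>))"
proof -
  define \<phi> where "\<phi> \<omega> s = f s (left_lim X s \<omega>) (left_lim Y s \<omega>) (U s \<omega>)" for \<omega> s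
  obtain N where N: "has_compensated_integral M F T (jump_measure T X) (pdmp_compensator T lam Q Tn X) U N"
    and Y: "AE \<omega> in M. \<forall>t\<in>{0..T}. Y t \<omega> = g (X T \<omega>) + (LINT s:{t<..T}|dA \<omega>. \<phi> \<omega> s) - (N T \<omega> - N t \<omega>)"
    using sol unfolding bsde_solution_def \<phi>_def by blast
  have int: "AE \<omega> in M. set_integrable (dA \<omega>) {0<..T} (\<phi> \<omega>)"
    using sol unfolding bsde_solution_def \<phi>_def by blast
  have Ncad: "cadlag M T N" and Nj: "AE \<omega> in M. \<forall>t\<in>{0<..T}. ereal (jump N t \<omega>) =
      W_tilde (jump_measure T X) (pdmp_compensator T lam Q Tn X) U t \<omega>"
    using N by (auto simp: has_compensated_integral_def purely_discontinuous_local_martingale_def local_martingale_def)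
  show ?thesis
    using AE_space Y int Nj Y_v
  proof eventually_elim
    case (elim \<omega>)
    note \<omega> = elim(1)
    show ?case
    proof
      fix s assume s: "s \<in> {0<..T}"
      have *: "ereal (jump N s \<omega>) = (if left_lim X s \<omega> \<in> {0, 1} \<longrightarrow> integrable (jump_law Q X (\<omega>, s)) (U s \<omega>)
         then ereal ((if jump X s \<omega> \<noteq> 0 then U s \<omega> (jump X s \<omega>) else 0) -
           indicator {0, 1} (left_lim X s \<omega>) * (LINT x|jump_law Q X (\<omega>, s). U s \<omega> x))
         else \<infinity>)"
        using elim(4) s W_tilde_pdmp[OF fps X U \<omega> s] by simp
      then have intU: "left_lim X s \<omega> \<in> {0, 1} \<longrightarrow> integrable (jump_law Q X (\<omega>, s)) (U s \<omega>)"
        by (metis PInfty_neq_ereal(1))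
      from trans[OF * if_P[OF this]] have jN: "jump N s \<omega> = (if jump X s \<omega> \<noteq> 0 then U s \<omega> (jump X s \<omega>) else 0) -
           indicator {0, 1} (left_lim X s \<omega>) * (LINT x|jump_law Q X (\<omega>, s). U s \<omega> x)"
        by simp
      have ms: "measure (dA \<omega>) {s} = indicator {0, 1} (left_lim X s \<omega>)"
        unfolding measure_def dA by (simp add: A_process_atom[OF fps X \<omega> s] indicator_def)
      have "((\<lambda>u. g (X T \<omega>) + (LINT r:{u<..T}|dA \<omega>. \<phi> \<omega> r) - (N T \<omega> - N u \<omega>)) \<longlongrightarrow>
        g (X T \<omega>) + ((LINT r:{s<..T}|dA \<omega>. \<phi> \<omega> r) + \<phi> \<omega> s * measure (dA \<omega>) {s}) - (N T \<omega> - left_lim N s \<omega>)) (at_left s)"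
        using left_limit_tail_integral[OF _ elim(3) s] left_lim_tendsto[OF Ncad \<omega> s]
        by (intro tendsto_intros) (auto simp: dA sets_stieltjes)
      moreover have "\<forall>\<^sub>F u in at_left s. u \<in> {0..T}"
        using s eventually_at_leftI[of 0 s "\<lambda>u. u \<in> {0..T}"] by auto
      then have "\<forall>\<^sub>F u in at_left s. g (X T \<omega>) + (LINT r:{u<..T}|dA \<omega>. \<phi> \<omega> r) - (N T \<omega> - N u \<omega>) = Y u \<omega>"
        by eventually_elim (use elim(2) in simp)
      ultimately have "((\<lambda>u. Y u \<omega>) \<longlongrightarrow>
        g (X T \<omega>) + ((LINT r:{s<..T}|dA \<omega>. \<phi> \<omega> r) + \<phi> \<omega> s * measure (dA \<omega>) {s}) - (N T \<omega> - left_lim N s \<omega>)) (at_left s)"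
        by (rule Lim_transform_eventually)
      then have "left_lim Y s \<omega> =
        g (X T \<omega>) + ((LINT r:{s<..T}|dA \<omega>. \<phi> \<omega> r) + \<phi> \<omega> s * measure (dA \<omega>) {s}) - (N T \<omega> - left_lim N s \<omega>)"
        by (rule left_lim_eqI) (use s in simp)
      moreover have "Y s \<omega> = g (X T \<omega>) + (LINT r:{s<..T}|dA \<omega>. \<phi> \<omega> r) - (N T \<omega> - N s \<omega>)" using elim(2) s by auto
      moreover have "Y s \<omega> = v s (X s \<omega>)" using elim(5) s by auto
      moreover have "left_lim Y s \<omega> = v s (left_lim X s \<omega>)"
        by (rule left_lim_continuous_image[OF v pdmpD(4)[OF X] \<omega> s]) (use elim(5) in blast)
      ultimately have "v s (X s \<omega>) - v s (left_lim X s \<omega>) = jump N s \<omega> - \<phi> \<omega> s * indicator {0, 1} (left_lim X s \<omega>)"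
        unfolding ms by (simp add: jump_def)
      also have "\<dots> = (if jump X s \<omega> \<noteq> 0 then U s \<omega> (jump X s \<omega>) else 0) -
          indicator {0, 1} (left_lim X s \<omega>) * ((LINT x|jump_law Q X (\<omega>, s). U s \<omega> x) + \<phi> \<omega> s)"
        unfolding jN by (simp add: algebra_simps)
      finally show "(left_lim X s \<omega> \<in> {0, 1} \<longrightarrow> integrable (jump_law Q X (\<omega>, s)) (U s \<omega>)) \<and>
          v s (X s \<omega>) - v s (left_lim X s \<omega>) = (if jump X s \<omega> \<noteq> 0 then U s \<omega> (jump X s \<omega>) else 0) -
          indicator {0, 1} (left_lim X s \<omega>) *
          ((LINT x|jump_law Q X (\<omega>, s). U s \<omega> x) + f s (left_lim X s \<omega>) (left_lim Y s \<omega>) (U s \<omega>))"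
        using intU unfolding \<phi>_def by blast
    qed
  qed
qed

section \<open>Null sets of the compensator\<close>

text \<open>By the disintegration of \<open>\<nu>\<close> along \<open>dA\<close>, a section that is null for \<open>\<nu>(\<omega>)\<close> is null for the jump law
  at all times outside a \<open>dA\<close>-null set \<open>Z\<close>.\<close>

lemma compensator_null_paths:
  assumes fps: "filtered_prob_space M F T" and X: "pdmp M F T h lam Q \<Phi> Tn \<zeta> X" and \<omega>: "\<omega> \<in> space M"
    and B: "B \<in> sets (predictable_sigma_tilde M F T)"
    and null: "rm_integral (pdmp_compensator T lam Q Tn X) (indicator B) T \<omega> = 0"
  obtains Z where "Z \<in> sets borel" "Z \<subseteq> {0<..T}" "emeasure (stieltjes T (A_process lam Tn X) \<omega>) Z = 0"
    "\<And>s. s \<in> {0<..T} - Z \<Longrightarrow> emeasure (jump_law Q X (\<omega>, s)) {x. ((\<omega>, s), x) \<in> B} = 0"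
proof -
  let ?K = "stieltjes T (A_process lam Tn X)"
  have B': "{z. ((\<omega>, fst z), snd z) \<in> B} \<in> sets borel" by (rule predictable_tilde_section_sets[OF fps \<omega> B])
  then have B'': "{z. ((\<omega>, fst z), snd z) \<in> B} \<inter> {0<..T} \<times> UNIV \<in> sets borel" by (auto simp: borel_prod[symmetric])
  define q where "q s = emeasure (jump_law Q X (\<omega>, s)) {x. ((\<omega>, s), x) \<in> B}" for s
  have spK: "space (?K \<omega>) = {0<..T}" by (simp add: stieltjes_def space_restrict_space)
  have q: "q \<in> borel_measurable (?K \<omega>)"
    using emeasure_kernel_measure(2)[where K="?K", OF fps X \<omega> sets_stieltjes B'] by (simp add: q_def[abs_def])
  have "(\<integral>\<^sup>+s. q s \<partial>?K \<omega>) =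
      (\<integral>\<^sup>+s. emeasure (jump_law Q X (\<omega>, s)) {x. (s, x) \<in> {z. ((\<omega>, fst z), snd z) \<in> B} \<inter> {0<..T} \<times> UNIV} \<partial>?K \<omega>)"
    by (intro nn_integral_cong) (simp add: q_def spK)
  also have "\<dots> = emeasure (pdmp_compensator T lam Q Tn X \<omega>) ({z. ((\<omega>, fst z), snd z) \<in> B} \<inter> {0<..T} \<times> UNIV)"
    unfolding pdmp_compensator_def by (rule emeasure_kernel_measure(3)[where K="?K", OF fps X \<omega> sets_stieltjes B'', symmetric])
  also have "\<dots> = 0"
    using null rm_integral_indicator[where \<eta>="pdmp_compensator T lam Q Tn X", OF fps \<omega> B sets_pdmp_compensator[OF fps X \<omega>]] by simp
  finally have "emeasure (?K \<omega>) {s \<in> space (?K \<omega>). q s \<noteq> 0} = 0"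
    using q by (simp add: nn_integral_0_iff)
  moreover have "{s \<in> space (?K \<omega>). q s \<noteq> 0} \<in> sets (?K \<omega>)" using q by measurable
  then have "{s \<in> {0<..T}. q s \<noteq> 0} \<in> sets borel" by (simp add: spK sets_stieltjes sets_restrict_space_iff)
  ultimately show ?thesis
    by (intro that[of "{s \<in> {0<..T}. q s \<noteq> 0}"]) (auto simp: spK q_def)
qed

text \<open>Both parts of \<open>dA\<close> are dominated by \<open>dA\<close>, so they ignore \<open>Z\<close>. A time at which \<open>X\<^sub>s\<^sub>-\<close> is on the
  boundary is an atom of \<open>dA\<close>; hence it is never exceptional, and statements about such times hold for all of
  them and not merely for almost all.\<close>

lemma A_process_null_set:
  assumes fps: "filtered_prob_space M F T" and X: "pdmp M F T h lam Q \<Phi> Tn \<zeta> X" and \<omega>: "\<omega> \<in> space M"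
    and Z: "Z \<in> sets borel" "Z \<subseteq> {0<..T}" "emeasure (stieltjes T (A_process lam Tn X) \<omega>) Z = 0"
  shows "AE s in lborel. 0 < indicator {0<..T} s * lam (left_lim X s \<omega>) \<longrightarrow> s \<notin> Z"
    "emeasure (stieltjes T (p_star Tn X) \<omega>) Z = 0"
    "s \<in> Z \<Longrightarrow> left_lim X s \<omega> \<notin> {0, 1}"
proof -
  have eq: "emeasure (density lborel (\<lambda>s. ennreal (indicator {0<..T} s * lam (left_lim X s \<omega>)))) Z = 0"
    "emeasure (interval_measure (\<lambda>t. p_star Tn X (max 0 (min t T)) \<omega>)) Z = 0"
    using interval_measure_A_process(1)[OF fps X \<omega> Z(1)] Z(3) by (simp_all add: emeasure_stieltjes[OF Z(2)])
  then show "emeasure (stieltjes T (p_star Tn X) \<omega>) Z = 0" by (simp add: emeasure_stieltjes[OF Z(2)])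
  have "AE s in density lborel (\<lambda>s. ennreal (indicator {0<..T} s * lam (left_lim X s \<omega>))). s \<notin> Z"
    using Z(1) eq(1) by (intro AE_not_in) (auto simp: null_sets_def)
  then show "AE s in lborel. 0 < indicator {0<..T} s * lam (left_lim X s \<omega>) \<longrightarrow> s \<notin> Z"
    using pdmp_jump_rate_integrable(1)[OF fps X \<omega>] by (subst (asm) AE_density) auto
  show "left_lim X s \<omega> \<notin> {0, 1}" if s: "s \<in> Z"
  proof
    assume "left_lim X s \<omega> \<in> {0, 1}"
    then have "1 = emeasure (stieltjes T (A_process lam Tn X) \<omega>) {s}"
      using A_process_atom[OF fps X \<omega>, of s] Z(2) s by auto
    also have "\<dots> \<le> emeasure (stieltjes T (A_process lam Tn X) \<omega>) Z"
      using Z s by (intro emeasure_mono) (auto simp: sets_stieltjes sets_restrict_space_iff)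
    finally show False using Z(3) by simp
  qed
qed

text \<open>The measure \<open>doleans M F T \<eta>\<close> is given by \<open>measure_of\<close>, which yields the zero measure if the set
  function is not countably additive. In either case its value on \<open>N\<close> is 0, so no additivity has to be checked.\<close>

lemma AE_doleansI:
  assumes N: "N \<in> sets (predictable_sigma_tilde M F T)"
    and null: "AE \<omega> in M. emeasure (\<eta> \<omega>) {z. ((\<omega>, fst z), snd z) \<in> N} = 0"
    and P: "\<And>z. z \<in> space (predictable_sigma_tilde M F T) \<Longrightarrow> z \<notin> N \<Longrightarrow> P z"
  shows "AE z in doleans M F T \<eta>. P z"
proof -
  have sp: "space (doleans M F T \<eta>) = space (predictable_sigma_tilde M F T)"
    and se: "sets (doleans M F T \<eta>) = sets (predictable_sigma_tilde M F T)"
    by (simp_all add: doleans_def space_measure_of_conv sets_measure_of_conv sets.space_closed sets.sigma_sets_eq)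
  have "(\<integral>\<^sup>+\<omega>. emeasure (\<eta> \<omega>) {z. ((\<omega>, fst z), snd z) \<in> N} \<partial>M) = (\<integral>\<^sup>+\<omega>. 0 \<partial>M)"
    using null by (rule nn_integral_cong_AE)
  then have "emeasure (doleans M F T \<eta>) N = 0"
    unfolding doleans_def by (simp add: emeasure_measure_of_conv)
  then show ?thesis
    using N P by (intro AE_I[of _ _ N]) (auto simp: sp se)
qed

text \<open>The weight of the interior measure vanishes unless \<open>X\<^sub>s\<^sub>- \<in> ]0,1[\<close>, so it suffices that \<open>C\<close> lies in the
  \<open>\<nu>\<close>-null set \<open>B\<close> over those times. The set \<open>C\<close> itself may be large over the boundary.\<close>

lemma AE_doleans_interior:
  assumes fps: "filtered_prob_space M F T" and X: "pdmp M F T h lam Q \<Phi> Tn \<zeta> X"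
    and B: "B \<in> sets (predictable_sigma_tilde M F T)"
    and null: "AE \<omega> in M. rm_integral (pdmp_compensator T lam Q Tn X) (indicator B) T \<omega> = 0"
    and C: "C \<in> sets (predictable_sigma_tilde M F T)"
    and CB: "\<And>\<omega> s x. ((\<omega>, s), x) \<in> C \<Longrightarrow> left_lim X s \<omega> \<in> {0<..<1} \<Longrightarrow> ((\<omega>, s), x) \<in> B"
  shows "AE z in doleans M F T (interior_measure T lam Q X). z \<notin> C"
proof (rule AE_doleansI[OF C])
  show "AE \<omega> in M. emeasure (interior_measure T lam Q X \<omega>) {z. ((\<omega>, fst z), snd z) \<in> C} = 0"
    using AE_space null
  proof eventually_elim
    case (elim \<omega>)
    note \<omega> = elim(1)
    obtain Z where Z: "Z \<in> sets borel" "Z \<subseteq> {0<..T}" "emeasure (stieltjes T (A_process lam Tn X) \<omega>) Z = 0"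
      and q: "\<And>s. s \<in> {0<..T} - Z \<Longrightarrow> emeasure (jump_law Q X (\<omega>, s)) {x. ((\<omega>, s), x) \<in> B} = 0"
      by (rule compensator_null_paths[OF fps X \<omega> B elim(2)]) blast
    define K where "K = (\<lambda>\<omega>. density (restrict_space lborel {0<..T})
        (\<lambda>s. ennreal (lam (left_lim X s \<omega>)) * indicator {0<..<1} (left_lim X s \<omega>)))"
    have K: "sets (K \<omega>) = sets (restrict_space borel {0<..T})"
      unfolding K_def sets_density by (rule sets_restrict_space_cong) simp
    have ll: "(\<lambda>s. left_lim X s \<omega>) \<in> borel_measurable (restrict_space lborel {0<..T})"
    proof -
      have "(\<lambda>s. s) \<in> measurable (restrict_space lborel {0<..T}) (restrict_space borel {0..T})"
        by (rule measurable_restrict_space3) auto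
      from measurable_compose[OF this pdmp_left_lim_measurable[OF fps X \<omega>]] show ?thesis .
    qed
    have d: "(\<lambda>s. ennreal (lam (left_lim X s \<omega>)) * indicator {0<..<1} (left_lim X s \<omega>)) \<in> borel_measurable (restrict_space lborel {0<..T})"
    proof -
      have "(\<lambda>s. indicator {0<..T} s * lam (left_lim X s \<omega>)) \<in> borel_measurable (restrict_space lborel {0<..T})"
        using pdmp_jump_rate_integrable(1)[OF fps X \<omega>] by (intro measurable_restrict_space1) simp
      then have "(\<lambda>s. ennreal (indicator {0<..T} s * lam (left_lim X s \<omega>)) * indicator {0<..<1} (left_lim X s \<omega>))
        \<in> borel_measurable (restrict_space lborel {0<..T})"
        using measurable_compose[OF ll borel_measurable_indicator[of "{0<..<1}" borel]]
        by (intro borel_measurable_times_ennreal measurable_compose[OF _ measurable_ennreal]) auto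
      then show ?thesis by (rule measurable_cong[THEN iffD1, rotated]) (simp add: space_restrict_space)
    qed
    have C': "{z. ((\<omega>, fst z), snd z) \<in> C} \<in> sets borel" by (rule predictable_tilde_section_sets[OF fps \<omega> C])
    have "AE s in lborel. s \<in> {0<..T} \<longrightarrow> 0 < ennreal (lam (left_lim X s \<omega>)) * indicator {0<..<1} (left_lim X s \<omega>) \<longrightarrow>
        emeasure (jump_law Q X (\<omega>, s)) {x. ((\<omega>, s), x) \<in> C} = 0"
      using A_process_null_set(1)[OF fps X \<omega> Z]
    proof eventually_elim
      case (elim s)
      show ?case
      proof (intro impI)
        assume s: "s \<in> {0<..T}" and "0 < ennreal (lam (left_lim X s \<omega>)) * indicator {0<..<1} (left_lim X s \<omega>)"
        moreover from this have int: "left_lim X s \<omega> \<in> {0<..<1}"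
          by (cases "left_lim X s \<omega> \<in> {0<..<1}") simp_all
        ultimately have "0 < lam (left_lim X s \<omega>)" by simp
        with elim s have "s \<in> {0<..T} - Z" by simp
        moreover have "{x. ((\<omega>, s), x) \<in> B} \<in> sets (jump_law Q X (\<omega>, s))"
          using measurable_sets[of "\<lambda>x. (s, x)" borel borel, OF _ predictable_tilde_section_sets[OF fps \<omega> B]]
          by (simp add: jump_law_def vimage_def)
        moreover have "{x. ((\<omega>, s), x) \<in> C} \<subseteq> {x. ((\<omega>, s), x) \<in> B}" using CB int by blast
        ultimately show "emeasure (jump_law Q X (\<omega>, s)) {x. ((\<omega>, s), x) \<in> C} = 0"
          using q[of s] emeasure_mono by (metis le_zero_eq)
      qed
    qed
    then have "AE s in K \<omega>. emeasure (jump_law Q X (\<omega>, s)) {x. ((\<omega>, s), x) \<in> C} = 0"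
      unfolding K_def AE_density[OF d] by (subst AE_restrict_space_iff) auto
    then have "(\<integral>\<^sup>+s. emeasure (jump_law Q X (\<omega>, s)) {x. ((\<omega>, s), x) \<in> C} \<partial>K \<omega>) = (\<integral>\<^sup>+s. 0 \<partial>K \<omega>)"
      by (rule nn_integral_cong_AE)
    moreover have "interior_measure T lam Q X \<omega> = kernel_measure K Q X \<omega>" by (simp add: interior_measure_def K_def)
    ultimately show ?case
      using emeasure_kernel_measure(3)[where K=K, OF fps X \<omega> K C'] by simp
  qed
qed

lemma AE_doleans_boundary:
  assumes fps: "filtered_prob_space M F T" and X: "pdmp M F T h lam Q \<Phi> Tn \<zeta> X"
    and B: "B \<in> sets (predictable_sigma_tilde M F T)"
    and null: "AE \<omega> in M. rm_integral (pdmp_compensator T lam Q Tn X) (indicator B) T \<omega> = 0"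
  shows "AE z in doleans M F T (boundary_measure T Q Tn X). z \<notin> B"
proof (rule AE_doleansI[OF B])
  show "AE \<omega> in M. emeasure (boundary_measure T Q Tn X \<omega>) {z. ((\<omega>, fst z), snd z) \<in> B} = 0"
    using AE_space null
  proof eventually_elim
    case (elim \<omega>)
    note \<omega> = elim(1)
    obtain Z where Z: "Z \<in> sets borel" "Z \<subseteq> {0<..T}" "emeasure (stieltjes T (A_process lam Tn X) \<omega>) Z = 0"
      and q: "\<And>s. s \<in> {0<..T} - Z \<Longrightarrow> emeasure (jump_law Q X (\<omega>, s)) {x. ((\<omega>, s), x) \<in> B} = 0"
      by (rule compensator_null_paths[OF fps X \<omega> B elim(2)]) blast
    define K where "K = (\<lambda>\<omega>. density (stieltjes T (p_star Tn X) \<omega>) (\<lambda>s. indicator {0, 1} (left_lim X s \<omega>)))"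
    have K: "sets (K \<omega>) = sets (restrict_space borel {0<..T})" unfolding K_def by (simp add: sets_stieltjes)
    have d: "(\<lambda>s. indicator {0, 1} (left_lim X s \<omega>) :: ennreal) \<in> borel_measurable (stieltjes T (p_star Tn X) \<omega>)"
    proof -
      have "(\<lambda>s. s) \<in> measurable (restrict_space borel {0<..T}) (restrict_space borel {0..T})"
        by (rule measurable_restrict_space3) auto
      from measurable_compose[OF measurable_compose[OF this pdmp_left_lim_measurable[OF fps X \<omega>]]
          borel_measurable_indicator[of "{0, 1}" borel]]
      show ?thesis by (simp cong: measurable_cong_sets add: sets_stieltjes)
    qed
    have "AE s in stieltjes T (p_star Tn X) \<omega>. s \<notin> Z"
      using A_process_null_set(2)[OF fps X \<omega> Z] Z
      by (intro AE_not_in) (auto simp: null_sets_def sets_stieltjes sets_restrict_space_iff)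
    then have "AE s in stieltjes T (p_star Tn X) \<omega>. emeasure (jump_law Q X (\<omega>, s)) {x. ((\<omega>, s), x) \<in> B} = 0"
      using AE_space by eventually_elim (use q in \<open>auto simp: stieltjes_def space_restrict_space\<close>)
    then have "AE s in K \<omega>. emeasure (jump_law Q X (\<omega>, s)) {x. ((\<omega>, s), x) \<in> B} = 0"
      unfolding K_def AE_density[OF d] by eventually_elim simp
    then have "(\<integral>\<^sup>+s. emeasure (jump_law Q X (\<omega>, s)) {x. ((\<omega>, s), x) \<in> B} \<partial>K \<omega>) = (\<integral>\<^sup>+s. 0 \<partial>K \<omega>)"
      by (rule nn_integral_cong_AE)
    moreover have "boundary_measure T Q Tn X \<omega> = kernel_measure K Q X \<omega>" by (simp add: boundary_measure_def K_def)
    ultimately show ?case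
      using emeasure_kernel_measure(3)[where K=K, OF fps X \<omega> K predictable_tilde_section_sets[OF fps \<omega> B]] by simp
  qed
qed

section \<open>Purely discontinuous local martingales without jumps\<close>

lemma finite_measure_subalgebra_filtration:
  assumes fps: "filtered_prob_space M F T" and "t \<le> T"
  shows "finite_measure_subalgebra M (F t)"
proof -
  interpret prob_space M by (rule filtered_prob_spaceD(2)[OF fps])
  show ?thesis by unfold_locales (rule subalgebra_filtration[OF assms])
qed

lemma local_martingale_zero:
  assumes fps: "filtered_prob_space M F T"
  shows "local_martingale M F T (\<lambda>t \<omega>. 0)"
proof -
  have "martingale M F T (\<lambda>t \<omega>. 0)"
    unfolding martingale_def
  proof (intro conjI allI impI)
    fix s t :: real assume "0 \<le> s \<and> s \<le> t \<and> t \<le> T"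
    then have "s \<le> T" by simp
    interpret finite_measure_subalgebra M "F s" by (rule finite_measure_subalgebra_filtration[OF fps \<open>s \<le> T\<close>])
    show "AE \<omega> in M. real_cond_exp M (F s) (\<lambda>\<omega>. 0) \<omega> = 0" by (rule real_cond_exp_F_meas) auto
  qed (auto simp: adapted_def)
  then have "martingale M F T (stopped (\<lambda>_. T) (\<lambda>t \<omega>. 0))" by (simp add: stopped_def[abs_def])
  moreover have "localizing M F T (\<lambda>_ _. T)"
    using filtered_prob_spaceD(1)[OF fps] by (auto simp: localizing_def stopping_time_def incseq_def)
  ultimately show ?thesis
    unfolding local_martingale_def
    by (intro conjI exI[of _ "\<lambda>_ _. T"]) (auto simp: adapted_def cadlag_def)
qed

lemma purely_discontinuous_zero:
  assumes fps: "filtered_prob_space M F T"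
  shows "purely_discontinuous_local_martingale M F T (\<lambda>t \<omega>. 0)"
  using local_martingale_zero[OF fps] by (simp add: purely_discontinuous_local_martingale_def)

lemma martingale_mean_zero:
  assumes fps: "filtered_prob_space M F T" and N: "martingale M F T N" and t: "t \<in> {0..T}"
    and 0: "AE \<omega> in M. N 0 \<omega> = 0"
  shows "integrable M (N t)" "(\<integral>\<omega>. N t \<omega> \<partial>M) = 0"
proof -
  show int: "integrable M (N t)" using N t by (simp add: martingale_def)
  interpret finite_measure_subalgebra M "F 0" using filtered_prob_spaceD(1)[OF fps] by (intro finite_measure_subalgebra_filtration[OF fps]) simp
  have "AE \<omega> in M. real_cond_exp M (F 0) (N t) \<omega> = N 0 \<omega>"
    using N t unfolding martingale_def by auto
  with 0 have "AE \<omega> in M. real_cond_exp M (F 0) (N t) \<omega> = 0" by eventually_elim simp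
  then have "(\<integral>\<omega>. real_cond_exp M (F 0) (N t) \<omega> \<partial>M) = (\<integral>\<omega>. 0 \<partial>M)"
    by (intro integral_cong_AE) auto
  then show "(\<integral>\<omega>. N t \<omega> \<partial>M) = 0" using real_cond_exp_int(2)[OF int] by simp
qed

lemma null_modification_borel:
  assumes fps: "filtered_prob_space M F T" and t: "0 \<le> t" and E: "E \<in> null_sets M" and f: "f \<in> borel_measurable (F t)"
  shows "(\<lambda>\<omega>. if \<omega> \<in> E then 0 else f \<omega> :: real) \<in> borel_measurable (F t)"
proof -
  have "E \<in> sets (F t)" using filtered_prob_spaceD(6,7)[OF fps] t E by blast
  then show ?thesis using f by (intro measurable_If_set) auto
qed

text \<open>A continuous local martingale has to have all its paths continuous, so a process that is continuous
  almost surely must first be changed on a null set. Adaptedness survives because null sets belong to every \<open>F t\<close> with \<open>t \<ge> 0\<close>.\<close>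

lemma local_martingale_modification:
  assumes fps: "filtered_prob_space M F T" and N: "local_martingale M F T N" and E: "E \<in> null_sets M"
  shows "local_martingale M F T (\<lambda>t \<omega>. if \<omega> \<in> E then 0 else N t \<omega>)"
proof -
  have mart: "martingale M F T (\<lambda>t \<omega>. if \<omega> \<in> E then 0 else K t \<omega>)" if K: "martingale M F T K" for K
    unfolding martingale_def
  proof (intro conjI allI impI ballI)
    have ae: "AE \<omega> in M. (if \<omega> \<in> E then 0 else K t \<omega>) = K t \<omega>" for t
      using AE_not_in[OF E] by eventually_elim simp
    show ad: "adapted F T (\<lambda>t \<omega>. if \<omega> \<in> E then 0 else K t \<omega>)"
      using K null_modification_borel[OF fps _ E] by (simp add: martingale_def adapted_def)
    have meas: "(\<lambda>\<omega>. if \<omega> \<in> E then 0 else K t \<omega>) \<in> borel_measurable M" "K t \<in> borel_measurable M" if t: "t \<in> {0..T}" for t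
    proof -
      have sub: "subalgebra M (F t)" using t by (intro subalgebra_filtration[OF fps]) simp
      show "(\<lambda>\<omega>. if \<omega> \<in> E then 0 else K t \<omega>) \<in> borel_measurable M" "K t \<in> borel_measurable M"
        by (rule measurable_from_subalg[OF sub], use ad K t in \<open>simp add: adapted_def martingale_def\<close>)+
    qed
    show "integrable M (\<lambda>\<omega>. if \<omega> \<in> E then 0 else K t \<omega>)" if t: "t \<in> {0..T}" for t
      using K t integrable_cong_AE[OF meas[OF t] ae[of t]] by (simp add: martingale_def)
    fix s t assume st: "0 \<le> s \<and> s \<le> t \<and> t \<le> T"
    interpret finite_measure_subalgebra M "F s" using st by (intro finite_measure_subalgebra_filtration[OF fps]) simp
    have "AE \<omega> in M. real_cond_exp M (F s) (\<lambda>\<omega>. if \<omega> \<in> E then 0 else K t \<omega>) \<omega> = real_cond_exp M (F s) (K t) \<omega>"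
      using st by (intro real_cond_exp_cong ae meas) auto
    moreover have "AE \<omega> in M. real_cond_exp M (F s) (K t) \<omega> = K s \<omega>" using K st by (simp add: martingale_def)
    ultimately show "AE \<omega> in M. real_cond_exp M (F s) (\<lambda>\<omega>. if \<omega> \<in> E then 0 else K t \<omega>) \<omega> = (if \<omega> \<in> E then 0 else K s \<omega>)"
      using ae[of s] by eventually_elim simp
  qed
  obtain \<tau> where \<tau>: "localizing M F T \<tau>" "\<And>n. martingale M F T (stopped (\<tau> n) N)"
    using N by (auto simp: local_martingale_def)
  have "stopped (\<tau> n) (\<lambda>t \<omega>. if \<omega> \<in> E then 0 else N t \<omega>) = (\<lambda>t \<omega>. if \<omega> \<in> E then 0 else stopped (\<tau> n) N t \<omega>)" for n
    by (intro ext) (simp add: stopped_def)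
  with mart[OF \<tau>(2)] have "martingale M F T (stopped (\<tau> n) (\<lambda>t \<omega>. if \<omega> \<in> E then 0 else N t \<omega>))" for n by simp
  moreover have "adapted F T (\<lambda>t \<omega>. if \<omega> \<in> E then 0 else N t \<omega>)"
    using N null_modification_borel[OF fps _ E] by (simp add: local_martingale_def adapted_def)
  moreover have "cadlag M T (\<lambda>t \<omega>. if \<omega> \<in> E then 0 else N t \<omega>)"
    unfolding cadlag_def
  proof
    fix \<omega> assume "\<omega> \<in> space M"
    then show "(\<forall>t\<in>{0..<T}. continuous (at_right t) (\<lambda>s. if \<omega> \<in> E then 0 else N s \<omega>)) \<and>
        (\<forall>t\<in>{0<..T}. \<exists>l. ((\<lambda>s. if \<omega> \<in> E then 0 else N s \<omega>) \<longlongrightarrow> l) (at_left t))"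
      using N by (cases "\<omega> \<in> E") (auto simp: local_martingale_def cadlag_def)
  qed
  ultimately show ?thesis using \<tau>(1) by (auto simp: local_martingale_def)
qed

lemma cadlag_no_jump_continuous:
  assumes cad: "cadlag M T N" and \<omega>: "\<omega> \<in> space M" and T: "0 < T" and nojump: "\<And>t. t \<in> {0<..T} \<Longrightarrow> jump N t \<omega> = 0"
  shows "continuous_on {0..T} (\<lambda>t. N t \<omega>)"
proof -
  have L: "((\<lambda>s. N s \<omega>) \<longlongrightarrow> N t \<omega>) (at_left t)" if "t \<in> {0<..T}" for t
    using left_lim_tendsto[OF cad \<omega> that] nojump[OF that] by (simp add: jump_def)
  have R: "((\<lambda>s. N s \<omega>) \<longlongrightarrow> N t \<omega>) (at_right t)" if "t \<in> {0..<T}" for t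
    using cad \<omega> that by (simp add: cadlag_def continuous_within)
  show ?thesis
    unfolding continuous_on
  proof
    fix t assume t: "t \<in> {0..T}"
    consider "t = 0" | "t = T" | "0 < t" "t < T" using t by fastforce
    then show "((\<lambda>s. N s \<omega>) \<longlongrightarrow> N t \<omega>) (at t within {0..T})"
    proof cases
      case 1 then show ?thesis using R[of 0] T by (simp add: at_within_Icc_at_right)
    next
      case 2 then show ?thesis using L[of T] T by (simp add: at_within_Icc_at_left)
    next
      case 3
      then have "at t within {0..T} = at t" by (intro at_within_Icc_at) auto
      then show ?thesis using L[of t] R[of t] 3 by (simp add: filterlim_split_at)
    qed
  qed
qed

text \<open>Up to a null set, \<open>N\<close> is a continuous local martingale, and it is orthogonal to all such, hence to
  itself: \<open>N\<^sup>2\<close> is a local martingale that starts at 0. Stopped, it is nonnegative with mean 0, so it vanishes.\<close>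

lemma purely_discontinuous_no_jump_zero:
  assumes fps: "filtered_prob_space M F T" and N: "purely_discontinuous_local_martingale M F T N"
    and nojump: "AE \<omega> in M. \<forall>t\<in>{0<..T}. jump N t \<omega> = 0"
  shows "AE \<omega> in M. \<forall>t\<in>{0..T}. N t \<omega> = 0"
proof -
  have T: "0 < T" by (rule filtered_prob_spaceD(1)[OF fps])
  have loc: "local_martingale M F T N" and N0: "AE \<omega> in M. N 0 \<omega> = 0"
    using N by (auto simp: purely_discontinuous_local_martingale_def)
  have cad: "cadlag M T N" using loc by (simp add: local_martingale_def)
  obtain E where "{\<omega> \<in> space M. \<not> (\<forall>t\<in>{0<..T}. jump N t \<omega> = 0)} \<subseteq> E" and E: "E \<in> null_sets M"
    using nojump unfolding eventually_ae_filter by blast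
  then have E': "\<forall>t\<in>{0<..T}. jump N t \<omega> = 0" if "\<omega> \<in> space M" "\<omega> \<notin> E" for \<omega>
    using that by blast
  define L where "L t \<omega> = (if \<omega> \<in> E then 0 else N t \<omega>)" for t \<omega>
  have "local_martingale M F T L" unfolding L_def[abs_def] by (rule local_martingale_modification[OF fps loc E])
  moreover have "continuous_on {0..T} (\<lambda>t. L t \<omega>)" if "\<omega> \<in> space M" for \<omega>
    using that cadlag_no_jump_continuous[OF cad that T] E'[of \<omega>] by (cases "\<omega> \<in> E") (simp_all add: L_def)
  ultimately have "continuous_local_martingale M F T L" by (simp add: continuous_local_martingale_def)
  then have "local_martingale M F T (\<lambda>t \<omega>. N t \<omega> * L t \<omega>)"
    using N by (simp add: purely_discontinuous_local_martingale_def)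
  then obtain \<tau> where \<tau>: "localizing M F T \<tau>" and mart: "\<And>n. martingale M F T (stopped (\<tau> n) (\<lambda>t \<omega>. N t \<omega> * L t \<omega>))"
    by (auto simp: local_martingale_def)
  have stop0: "AE \<omega> in M. N (min t (\<tau> n \<omega>)) \<omega> = 0" if t: "t \<in> {0..T}" for n t
  proof -
    let ?Z = "stopped (\<tau> n) (\<lambda>t \<omega>. N t \<omega> * L t \<omega>)"
    have "AE \<omega> in M. ?Z 0 \<omega> = 0"
      using N0 AE_space by eventually_elim (use \<tau> in \<open>auto simp: stopped_def localizing_def min_def\<close>)
    note Z = martingale_mean_zero[OF fps mart[of n] t this]
    have sq: "AE \<omega> in M. ?Z t \<omega> = (N (min t (\<tau> n \<omega>)) \<omega>)\<^sup>2"
      using AE_not_in[OF E] by eventually_elim (simp add: stopped_def L_def power2_eq_square)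
    then have "AE \<omega> in M. 0 \<le> ?Z t \<omega>" by eventually_elim simp
    then have "AE \<omega> in M. ?Z t \<omega> = 0"
      using integral_nonneg_eq_0_iff_AE[OF Z(1)] Z(2) by simp
    with sq show ?thesis by eventually_elim simp
  qed
  \<comment> \<open>Countably many times, so that one null set serves for all. Right continuity extends the result to
    \<open>[0,T[\<close> but gives nothing at \<open>T\<close>, which is therefore included.\<close>
  define D where "D = insert T (\<rat> \<inter> {0..T})"
  have "countable D" unfolding D_def by (simp add: countable_rat countable_Int1)
  then have "AE \<omega> in M. \<forall>n. \<forall>t\<in>D. N (min t (\<tau> n \<omega>)) \<omega> = 0"
    using stop0 T by (subst AE_all_countable, intro allI, subst AE_ball_countable) (auto simp: D_def)
  moreover have "AE \<omega> in M. \<exists>n. T \<le> \<tau> n \<omega>" using \<tau> by (simp add: localizing_def)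
  ultimately show ?thesis
    using AE_space
  proof eventually_elim
    case (elim \<omega>)
    obtain n where n: "T \<le> \<tau> n \<omega>" using elim(2) by blast
    have D: "N t \<omega> = 0" if "t \<in> D" for t
    proof -
      have "t \<le> T" using that T by (auto simp: D_def)
      then have "min t (\<tau> n \<omega>) = t" using n by simp
      then show ?thesis using elim(1) that by metis
    qed
    show ?case
    proof
      fix t assume t: "t \<in> {0..T}"
      show "N t \<omega> = 0"
      proof (cases "t = T")
        case True then show ?thesis using D by (simp add: D_def)
      next
        case False
        then have t': "t < T" using t by simp
        have lim: "((\<lambda>s. N s \<omega>) \<longlongrightarrow> N t \<omega>) (at_right t)"
          using cad elim(3) t t' by (simp add: cadlag_def continuous_within)
        have "\<exists>r. r \<in> \<rat> \<and> t < r \<and> r < min T (t + inverse (real (Suc k)))" for k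
          using Rats_dense_in_real[of t "min T (t + inverse (real (Suc k)))"] t' by auto
        then obtain r where r: "\<And>k. r k \<in> \<rat>" "\<And>k. t < r k" "\<And>k. r k < min T (t + inverse (real (Suc k)))"
          by metis
        have "r \<longlonglongrightarrow> t"
        proof (rule tendsto_sandwich[where f="\<lambda>_. t" and h="\<lambda>k. t + inverse (real (Suc k))"])
          show "(\<lambda>k. t + inverse (real (Suc k))) \<longlonglongrightarrow> t"
            using tendsto_add[OF tendsto_const[of t] LIMSEQ_inverse_real_of_nat] by simp
          show "\<forall>\<^sub>F k in sequentially. t \<le> r k" using r(2) by (intro always_eventually allI less_imp_le)
          show "\<forall>\<^sub>F k in sequentially. r k \<le> t + inverse (real (Suc k))"
            using r(3) by (intro always_eventually allI less_imp_le) (metis min_less_iff_conj)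
        qed simp
        moreover have "r k \<in> {t<..} \<and> r k \<noteq> t" for k using r(2)[of k] by auto
        ultimately have "filterlim r (at_right t) sequentially"
          unfolding filterlim_at by (blast intro: always_eventually)
        then have "(\<lambda>k. N (r k) \<omega>) \<longlonglongrightarrow> N t \<omega>" by (rule filterlim_compose[OF lim])
        moreover have "N (r k) \<omega> = 0" for k
        proof (rule D)
          have "0 \<le> r k" "r k \<le> T" using r(2,3)[of k] t by auto
          then show "r k \<in> D" using r(1) by (simp add: D_def)
        qed
        ultimately show ?thesis using LIMSEQ_unique[OF tendsto_const[of 0]] by simp
      qed
    qed
  qed
qed

text \<open>The sum of squares vanishes almost surely only, and nothing else is known of it; it is adapted
  because every subset of a null set belongs to \<open>F t\<close>.\<close>

lemma null_integrand_G_loc: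
  assumes fps: "filtered_prob_space M F T" and W: "predictable_field M F T W"
    and null: "AE \<omega> in M. \<forall>t\<in>{0<..T}. W_tilde \<mu> \<nu> W t \<omega> = 0"
  shows "W \<in> G_loc M F T \<mu> \<nu> 1"
proof -
  let ?V = "sum_sq_powr \<mu> \<nu> 1 W"
  have T: "0 < T" by (rule filtered_prob_spaceD(1)[OF fps])
  have V0: "AE \<omega> in M. \<forall>t\<in>{0..T}. ?V t \<omega> = 0"
    using null
  proof eventually_elim
    case (elim \<omega>)
    have "(\<integral>\<^sup>+s. (e2ennreal \<bar>W_tilde \<mu> \<nu> W s \<omega>\<bar>)\<^sup>2 \<partial>count_space {0<..t}) = (\<integral>\<^sup>+s. 0 \<partial>count_space {0<..t})" if "t \<le> T" for t
      using elim that by (intro nn_integral_cong) (auto simp: e2ennreal_neg)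
    then show ?case by (auto simp: sum_sq_powr_def ennreal_powr_def)
  qed
  have ad: "adapted F T ?V"
    unfolding adapted_def
  proof
    fix t assume t: "t \<in> {0..T}"
    obtain E where "{\<omega> \<in> space M. \<not> (\<forall>t\<in>{0..T}. ?V t \<omega> = 0)} \<subseteq> E" and E: "E \<in> null_sets M"
      using V0 unfolding eventually_ae_filter by blast
    then have E': "?V t \<omega> = 0" if "\<omega> \<in> space M" "\<omega> \<notin> E" for \<omega>
      using that t by blast
    show "?V t \<in> borel_measurable (F t)"
    proof (rule measurableI)
      fix A :: "ennreal set" assume "A \<in> sets borel"
      interpret complete_measure M by (rule filtered_prob_spaceD(3)[OF fps])
      have null: "S \<in> sets (F t)" if "S \<subseteq> E" for S
        using complete2[OF that E] filtered_prob_spaceD(6,7)[OF fps] t by (metis atLeastAtMost_iff subsetD)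
      have sp: "space (F t) = space M" by (rule filtered_prob_spaceD(4)[OF fps])
      show "?V t -` A \<inter> space (F t) \<in> sets (F t)"
      proof (cases "0 \<in> A")
        case True
        have "space (F t) - (?V t -` A \<inter> space (F t)) \<in> sets (F t)" using E' True by (intro null) (auto simp: sp)
        then have "space (F t) - (space (F t) - (?V t -` A \<inter> space (F t))) \<in> sets (F t)" by (rule sets.compl_sets)
        also have "space (F t) - (space (F t) - (?V t -` A \<inter> space (F t))) = ?V t -` A \<inter> space (F t)" by auto
        finally show ?thesis .
      next
        case False
        have "?V t -` A \<inter> space (F t) \<subseteq> E"
        proof
          fix \<omega> assume "\<omega> \<in> ?V t -` A \<inter> space (F t)"
          then show "\<omega> \<in> E" using False E'[of \<omega>] by (cases "\<omega> \<in> E") (auto simp: sp)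
        qed
        then show ?thesis by (rule null)
      qed
    qed simp
  qed
  have stop: "t \<in> {0..T} \<Longrightarrow> stopped (\<lambda>_. T) ?V t = ?V t" for t by (intro ext) (simp add: stopped_def min_def)
  have "stopped (\<lambda>_. T) ?V \<in> A_plus M F T"
    unfolding A_plus_def
  proof (intro CollectI conjI)
    show "adapted F T (stopped (\<lambda>_. T) ?V)" using ad stop by (simp add: adapted_def)
    show "AE \<omega> in M. stopped (\<lambda>_. T) ?V 0 \<omega> = 0 \<and> mono_on {0..T} (\<lambda>t. stopped (\<lambda>_. T) ?V t \<omega>) \<and>
        (\<forall>t\<in>{0..<T}. continuous (at_right t) (\<lambda>s. stopped (\<lambda>_. T) ?V s \<omega>))"
      using V0
    proof eventually_elim
      case (elim \<omega>)
      have z: "stopped (\<lambda>_. T) ?V t \<omega> = 0" if "0 \<le> t" for t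
        using elim that T by (simp add: stopped_def)
      have "continuous (at_right t) (\<lambda>s. stopped (\<lambda>_. T) ?V s \<omega>)" if t: "0 \<le> t" for t
        unfolding continuous_within z[OF t]
      proof (rule tendsto_eventually)
        show "\<forall>\<^sub>F s in at_right t. stopped (\<lambda>_. T) ?V s \<omega> = 0"
          unfolding eventually_at_right_field using z t by (intro exI[of _ "t + 1"]) auto
      qed
      then show ?case using z by (auto simp: mono_on_def)
    qed
    have "(\<integral>\<^sup>+\<omega>. stopped (\<lambda>_. T) ?V T \<omega> \<partial>M) = (\<integral>\<^sup>+\<omega>. 0 \<partial>M)"
      using V0 by (intro nn_integral_cong_AE) (use T in \<open>auto simp: stopped_def elim!: eventually_mono\<close>)
    then show "(\<integral>\<^sup>+\<omega>. stopped (\<lambda>_. T) ?V T \<omega> \<partial>M) < \<infinity>" by simp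
  qed
  moreover have "localizing M F T (\<lambda>_ _. T)"
    using T by (auto simp: localizing_def stopping_time_def incseq_def)
  ultimately show ?thesis using W ad unfolding G_loc_def A_plus_loc_def by blast
qed

section \<open>Identification of the integrand\<close>

lemma predictable_field_increment:
  assumes fps: "filtered_prob_space M F T" and X: "adapted F T X" "cadlag M T X"
    and v: "continuous_on ({0..T} \<times> UNIV) (\<lambda>(t, x). v t x)"
  shows "predictable_field M F T (\<lambda>s \<omega> x. v s (left_lim X s \<omega> + x) - v s (left_lim X s \<omega>))"
proof -
  let ?P = "predictable_sigma_tilde M F T"
  have ll: "(\<lambda>z. left_lim X (snd (fst z)) (fst (fst z))) \<in> borel_measurable ?P"
    unfolding predictable_sigma_tilde_def
    by (rule measurable_compose[OF measurable_fst predictable_left_lim[OF fps X]])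
  have time: "(\<lambda>z. snd (fst z)) \<in> borel_measurable ?P"
    unfolding predictable_sigma_tilde_def
    by (rule measurable_compose[OF measurable_fst measurable_predictable_time[OF fps]])
  have mark: "snd \<in> borel_measurable ?P" unfolding predictable_sigma_tilde_def by simp
  have comp: "(\<lambda>z. v (snd (fst z)) (y z)) \<in> borel_measurable ?P" if y: "y \<in> borel_measurable ?P" for y :: "('a \<times> real) \<times> real \<Rightarrow> real"
  proof -
    have "(\<lambda>z. (snd (fst z), y z)) \<in> measurable ?P (restrict_space borel ({0..T} \<times> UNIV))"
      using borel_measurable_Pair[OF time y]
      by (intro measurable_restrict_space2) (auto simp: predictable_sigma_tilde_def space_pair_measure space_predictable_sigma[OF fps])
    from measurable_compose[OF this borel_measurable_continuous_on_restrict[OF v]] show ?thesis by simp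
  qed
  have "(\<lambda>z. v (snd (fst z)) (left_lim X (snd (fst z)) (fst (fst z)) + snd z) -
      v (snd (fst z)) (left_lim X (snd (fst z)) (fst (fst z)))) \<in> borel_measurable ?P"
    by (intro borel_measurable_diff comp borel_measurable_add ll mark)
  then show ?thesis unfolding predictable_field_def by (simp add: case_prod_unfold)
qed

lemma predictable_jump_law_integral:
  assumes fps: "filtered_prob_space M F T" and X: "pdmp M F T h lam Q \<Phi> Tn \<zeta> X" and U: "predictable_field M F T U"
  shows "predictable M F T (\<lambda>s \<omega>. LINT x|jump_law Q X (\<omega>, s). U s \<omega> x)"
proof -
  let ?P = "predictable_sigma M F T"
  let ?u = "\<lambda>z. U (snd (fst z)) (fst (fst z)) (snd z)"
  have u: "?u \<in> borel_measurable (?P \<Otimes>\<^sub>M borel)"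
    using U by (simp add: predictable_field_def predictable_sigma_tilde_def case_prod_unfold)
  have "(\<lambda>z. distr (jump_law Q X z) (?P \<Otimes>\<^sub>M borel) (\<lambda>x. (z, x))) \<in> measurable ?P (subprob_algebra (?P \<Otimes>\<^sub>M borel))"
    by (rule measurable_distr2[OF _ measurable_prob_algebraD[OF jump_law_kernel[OF fps X]]]) simp
  from measurable_compose[OF this integral_measurable_subprob_algebra[OF u]]
  have "(\<lambda>z. LINT x|distr (jump_law Q X z) (?P \<Otimes>\<^sub>M borel) (\<lambda>x. (z, x)). ?u x) \<in> borel_measurable ?P" .
  moreover have "(LINT x|distr (jump_law Q X z) (?P \<Otimes>\<^sub>M borel) (\<lambda>x. (z, x)). ?u x) = (LINT x|jump_law Q X z. U (snd z) (fst z) x)"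
    if "z \<in> space ?P" for z
  proof -
    have "(\<lambda>x. (z, x)) \<in> measurable (jump_law Q X z) (?P \<Otimes>\<^sub>M borel)"
      using measurable_Pair1'[OF that, of borel] by (simp cong: measurable_cong_sets add: jump_law_def)
    then show ?thesis by (subst integral_distr[OF _ u]) simp_all
  qed
  ultimately have "(\<lambda>z. LINT x|jump_law Q X z. U (snd z) (fst z) x) \<in> borel_measurable ?P"
    by (simp cong: measurable_cong)
  then show ?thesis by (simp add: predictable_def case_prod_unfold)
qed

theorem corollary5p9:
  fixes M :: "'a measure" and F :: "real \<Rightarrow> 'a measure" and T :: real
    and h lam :: "real \<Rightarrow> real" and Q :: "real \<Rightarrow> real measure" and \<Phi> :: "real \<Rightarrow> real \<Rightarrow> real"
    and Tn :: "nat \<Rightarrow> 'a \<Rightarrow> ereal" and \<zeta> :: "nat \<Rightarrow> 'a \<Rightarrow> real"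
    and X Y :: "real \<Rightarrow> 'a \<Rightarrow> real" and U H :: "real \<Rightarrow> 'a \<Rightarrow> real \<Rightarrow> real"
    and dA :: "'a \<Rightarrow> real measure" and \<mu> \<nu> :: "'a \<Rightarrow> (real \<times> real) measure"
    and g :: "real \<Rightarrow> real" and f :: "real \<Rightarrow> real \<Rightarrow> real \<Rightarrow> (real \<Rightarrow> real) \<Rightarrow> real"
    and v :: "real \<Rightarrow> real \<Rightarrow> real"
  assumes space: "filtered_prob_space M F T"
    and X: "pdmp M F T h lam Q \<Phi> Tn \<zeta> X"
    and dA_eq: "dA = stieltjes T (A_process lam Tn X)"
    and mu_eq: "\<mu> = jump_measure T X"
    and nu_eq: "\<nu> = pdmp_compensator T lam Q Tn X"
    and nu: "compensator M F T \<mu> \<nu>"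
    and Y: "Y \<in> L2_space M dA"
    and U: "U \<in> G M F T \<mu> \<nu> 2"
    and sol: "bsde_solution M F T X dA \<mu> \<nu> g f Y U"
    and v: "continuous_on ({0..T} \<times> UNIV) (\<lambda>(t, x). v t x)"
    and Y_v: "AE \<omega> in M. \<forall>t\<in>{0..T}. Y t \<omega> = v t (X t \<omega>)"
    and H_eq: "H = (\<lambda>s \<omega> x. U s \<omega> x - (v s (left_lim X s \<omega> + x) - v s (left_lim X s \<omega>)))"
  shows "((\<exists>N. has_compensated_integral M F T \<mu> \<nu> H N) \<and>
          (\<forall>N. has_compensated_integral M F T \<mu> \<nu> H N \<longrightarrow>
               (AE \<omega> in M. \<forall>t\<in>{0<..T}. N t \<omega> = 0))) \<and>
         (H \<in> G_loc M F T \<mu> \<nu> 2 \<longrightarrow>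
          (AE ((\<omega>, s), x) in doleans M F T (interior_measure T lam Q X).
             U s \<omega> x = v s (left_lim X s \<omega> + x) - v s (left_lim X s \<omega>)) \<and>
          (\<exists>l. predictable M F T l \<and>
             (AE ((\<omega>, s), x) in doleans M F T (boundary_measure T Q Tn X).
                U s \<omega> x = v s (left_lim X s \<omega> + x) - v s (left_lim X s \<omega>) + l s \<omega>)))"
proof -
  define k where "k s \<omega> = indicator {0, 1} (left_lim X s \<omega>) *
    ((LINT x|jump_law Q X (\<omega>, s). U s \<omega> x) + f s (left_lim X s \<omega>) (left_lim Y s \<omega>) (U s \<omega>))" for s \<omega>
  let ?P = "predictable_sigma_tilde M F T"
  note fps = space
  have Upf: "predictable_field M F T U" using U by (simp add: G_def)
  have Hpf: "predictable_field M F T H"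
    using Upf predictable_field_increment[OF fps pdmpD(3,4)[OF X] v]
    unfolding H_eq predictable_field_def by (simp add: case_prod_unfold)
  have kp: "predictable M F T k"
  proof -
    have "(\<lambda>z. indicator {0, 1} (left_lim X (snd z) (fst z)) :: real) \<in> borel_measurable (predictable_sigma M F T)"
      by (rule measurable_compose[OF predictable_left_lim[OF fps pdmpD(3,4)[OF X]]]) simp
    moreover have "predictable M F T (\<lambda>s \<omega>. f s (left_lim X s \<omega>) (left_lim Y s \<omega>) (U s \<omega>))"
      using sol by (simp add: bsde_solution_def)
    ultimately show ?thesis
      using predictable_jump_law_integral[OF fps X Upf]
      unfolding predictable_def k_def case_prod_unfold by (intro borel_measurable_times borel_measurable_add)
  qed
  \<comment> \<open>The set on which the whole proof turns: negligible for \<open>\<mu>\<close> by the jump equation, hence for \<open>\<nu>\<close>.\<close>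
  define B where "B = {z \<in> space ?P. H (snd (fst z)) (fst (fst z)) (snd z) \<noteq> k (snd (fst z)) (fst (fst z))}"
  define C where "C = {z \<in> space ?P. H (snd (fst z)) (fst (fst z)) (snd z) \<noteq> 0}"
  have Hm: "(\<lambda>z. H (snd (fst z)) (fst (fst z)) (snd z)) \<in> borel_measurable ?P"
    using Hpf by (simp add: predictable_field_def case_prod_unfold)
  have km: "(\<lambda>z. k (snd (fst z)) (fst (fst z))) \<in> borel_measurable ?P"
    using measurable_compose[OF measurable_fst, of "\<lambda>z. k (snd z) (fst z)"] kp
    by (simp add: predictable_def predictable_sigma_tilde_def case_prod_unfold)
  have B: "B \<in> sets ?P" unfolding B_def using Hm km by measurable
  have C: "C \<in> sets ?P" unfolding C_def using Hm by measurable
  have inP: "((\<omega>, s), x) \<in> space ?P \<longleftrightarrow> \<omega> \<in> space M \<and> s \<in> {0..T}" for \<omega> s x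
    by (auto simp: predictable_sigma_tilde_def space_pair_measure space_predictable_sigma[OF fps])
  have jumps: "AE \<omega> in M. \<forall>s\<in>{0<..T}. if jump X s \<omega> \<noteq> 0 then H s \<omega> (jump X s \<omega>) = k s \<omega> else k s \<omega> = 0"
    using bsde_jump[OF fps X dA_eq Upf sol[unfolded mu_eq nu_eq] v Y_v]
  proof eventually_elim
    case (elim \<omega>)
    show ?case
    proof
      fix s assume "s \<in> {0<..T}"
      with elim have *: "v s (X s \<omega>) - v s (left_lim X s \<omega>) = (if jump X s \<omega> \<noteq> 0 then U s \<omega> (jump X s \<omega>) else 0) - k s \<omega>"
        unfolding k_def by blast
      have "X s \<omega> = left_lim X s \<omega> + jump X s \<omega>" by (simp add: jump_def)
      with * show "if jump X s \<omega> \<noteq> 0 then H s \<omega> (jump X s \<omega>) = k s \<omega> else k s \<omega> = 0"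
        unfolding H_eq by (cases "jump X s \<omega> = 0") auto
    qed
  qed
  then have "AE \<omega> in M. rm_integral \<mu> (indicator B) T \<omega> = 0"
    using AE_space
  proof eventually_elim
    case (elim \<omega>)
    show ?case
      unfolding mu_eq
      by (rule rm_integral_jump_measure_null[OF fps elim(2) B]) (use elim(1) in \<open>auto simp: B_def\<close>)
  qed
  then have null: "AE \<omega> in M. rm_integral (pdmp_compensator T lam Q Tn X) (indicator B) T \<omega> = 0"
    using compensator_null[OF fps nu B] nu_eq by simp
  have H0: "AE \<omega> in M. \<forall>s\<in>{0<..T}. W_tilde \<mu> \<nu> H s \<omega> = 0"
    using null jumps AE_space
  proof eventually_elim
    case (elim \<omega>)
    note \<omega> = elim(3)
    obtain Z where Z: "Z \<in> sets borel" "Z \<subseteq> {0<..T}" "emeasure (stieltjes T (A_process lam Tn X) \<omega>) Z = 0"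
      and q: "\<And>s. s \<in> {0<..T} - Z \<Longrightarrow> emeasure (jump_law Q X (\<omega>, s)) {x. ((\<omega>, s), x) \<in> B} = 0"
      by (rule compensator_null_paths[OF fps X \<omega> B elim(1)]) blast
    show ?case
    proof
      fix s assume s: "s \<in> {0<..T}"
      note W = W_tilde_pdmp[OF fps X Hpf \<omega> s, folded mu_eq nu_eq]
      \<comment> \<open>If \<open>X\<close> does not jump at \<open>s\<close>, both sides are 0.\<close>
      have jk: "(if jump X s \<omega> \<noteq> 0 then H s \<omega> (jump X s \<omega>) else 0) = k s \<omega>"
        using elim(2) s by (auto split: if_splits)
      show "W_tilde \<mu> \<nu> H s \<omega> = 0"
      proof (cases "left_lim X s \<omega> \<in> {0, 1}")
        case False
        then have "k s \<omega> = 0" by (simp add: k_def)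
        then show ?thesis using W jk False by simp
      next
        case True
        \<comment> \<open>Boundary times are atoms of \<open>dA\<close>, so none of them is lost in the exceptional set.\<close>
        then have "s \<notin> Z" using A_process_null_set(3)[OF fps X \<omega> Z] by blast
        interpret L: prob_space "jump_law Q X (\<omega>, s)" using jump_law_prob_space(1)[OF fps X \<omega>, of s] s by simp
        have Lsets: "sets (jump_law Q X (\<omega>, s)) = sets borel" by (simp add: jump_law_def)
        have Hs: "H s \<omega> \<in> borel_measurable (jump_law Q X (\<omega>, s))"
          using predictable_field_section[OF fps Hpf \<omega>, of s] s by (simp cong: measurable_cong_sets add: Lsets)
        have "{x. ((\<omega>, s), x) \<in> B} = {x \<in> space (jump_law Q X (\<omega>, s)). H s \<omega> x \<noteq> k s \<omega>}"
          using \<omega> s by (auto simp: B_def inP jump_law_def)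
        then have "AE x in jump_law Q X (\<omega>, s). H s \<omega> x = k s \<omega>"
          using q[of s] s \<open>s \<notin> Z\<close> Hs by (subst AE_iff_measurable[OF _ refl]) auto
        from integrable_cong_AE[OF Hs borel_measurable_const this] integral_cong_AE[OF Hs borel_measurable_const this]
        have "integrable (jump_law Q X (\<omega>, s)) (H s \<omega>)" "(LINT x|jump_law Q X (\<omega>, s). H s \<omega> x) = k s \<omega>"
          by (simp_all add: L.prob_space)
        then show ?thesis using W jk True by simp
      qed
    qed
  qed
  have "H \<in> G_loc M F T \<mu> \<nu> 1" by (rule null_integrand_G_loc[OF fps Hpf H0])
  then have "has_compensated_integral M F T \<mu> \<nu> H (\<lambda>t \<omega>. 0)"
    using purely_discontinuous_zero[OF fps] H0
    by (auto simp: has_compensated_integral_def jump_def left_lim_def tendsto_Lim elim!: eventually_mono)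
  moreover have "AE \<omega> in M. \<forall>t\<in>{0<..T}. N t \<omega> = 0" if N: "has_compensated_integral M F T \<mu> \<nu> H N" for N
  proof -
    have "AE \<omega> in M. \<forall>t\<in>{0<..T}. ereal (jump N t \<omega>) = W_tilde \<mu> \<nu> H t \<omega>"
      using N by (simp add: has_compensated_integral_def)
    with H0 have "AE \<omega> in M. \<forall>t\<in>{0<..T}. jump N t \<omega> = 0" by eventually_elim simp
    with N have "AE \<omega> in M. \<forall>t\<in>{0..T}. N t \<omega> = 0"
      by (intro purely_discontinuous_no_jump_zero[OF fps]) (auto simp: has_compensated_integral_def)
    then show ?thesis by eventually_elim simp
  qed
  moreover have "AE z in doleans M F T (interior_measure T lam Q X). z \<notin> C"
    by (rule AE_doleans_interior[OF fps X B null C]) (auto simp: B_def C_def k_def)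
  then have "AE ((\<omega>, s), x) in doleans M F T (interior_measure T lam Q X).
      U s \<omega> x = v s (left_lim X s \<omega> + x) - v s (left_lim X s \<omega>)"
    using AE_space by eventually_elim (auto simp: C_def H_eq doleans_def space_measure_of_conv)
  moreover have "AE z in doleans M F T (boundary_measure T Q Tn X). z \<notin> B"
    by (rule AE_doleans_boundary[OF fps X B null])
  then have "AE ((\<omega>, s), x) in doleans M F T (boundary_measure T Q Tn X).
      U s \<omega> x = v s (left_lim X s \<omega> + x) - v s (left_lim X s \<omega>) + k s \<omega>"
    using AE_space by eventually_elim (auto simp: B_def H_eq doleans_def space_measure_of_conv)
  ultimately show ?thesis using kp by blast
qed

end
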